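(* For every first order formula $\varphi$ we have $\mathrm{fotw}(\varphi)\le\mathrm{tw}(G_\varphi,\mathrm{ad}_\varphi)$.
   Context: Formulae are of relational first-order logic with constants, in negation normal form, and straight: no variable is quantified twice, no free variable is also quantified, every quantified variable occurs in some atom (non-straight formulae are first made straight by renaming). $\mathrm{var}(\varphi)$ is the set of variables of $\varphi$. The formula graph $G_\varphi$ has vertex set $\mathrm{var}(\varphi)$ and an edge $\{x,y\}$ ($x\neq y$) whenever $x,y$ are both free in $\varphi$ or occur together in some atom. For a bound variable $x$, $Q_x\in\{\exists,\forall\}$ is its quantifier and its scope is the subformula $\psi$ with $Q_xx\psi$ a subformula of $\varphi$. For bound $x,y$, $x\le_\varphi y$ means $x=y$ or $y$ is quantified in the scope of $x$. For a set $X$ of variables, $\varphi_{[X]}$ is the minimal (w.r.t. subformulaship) subformula of $\varphi$ containing all atoms using variables from $X$. For a binary relation $\trianglelefteq$ on $\mathrm{var}(\varphi)$, $x,y$ are entangled w.r.t. $\trianglelefteq$ and $\varphi$ if $x$ occurs in $\varphi_{[\{z: y\trianglelefteq z\}]}$ and $y$ occurs in $\varphi_{[\{z:x\trianglelefteq z\}]}$. $\preceq_\varphi$ is the smallest binary relation on $\mathrm{var}(\varphi)$ that is reflexive, transitive, and satisfies: if $x\le_\varphi y$, $Q_x\ne Q_y$, and there is a sequence $x=z_0,\dots,z_n=y$ of bound variables such that for all $0\le i<n$, $z_i,z_{i+1}$ are entangled w.r.t. $\preceq_\varphi$ and $\varphi$ and ($x\preceq_\varphi z_i$ or $y\preceq_\varphi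 z_i$), then $x\preceq_\varphi y$. For a relation $R\in\{\preceq_\varphi,\le_\varphi\}$, define the depth function $\delta_R(x)=0$ for free $x$, and for bound $x$ the maximum over all sequences $v_1,\dots,v_m=x$ with $v_iRv_{i+1}$, $v_i\ne v_{i+1}$, of the number of indices $i$ with $Q_{v_i}\ne Q_{v_{i+1}}$, plus $1$ if $Q_{v_1}=\exists$ and plus $2$ if $Q_{v_1}=\forall$. The essential alternation depth is $\mathrm{ead}_\varphi:=\delta_{\preceq_\varphi}$ and the alternation depth is $\mathrm{ad}_\varphi:=\delta_{\le_\varphi}$. A tree decomposition $(T,B)$ of a graph $G$ (rooted tree $T$, pieces $B_t\subseteq V(G)$ covering all vertices and edges, with $\{t:v\in B_t\}$ connected for each $v$; width $\max|B_t|-1$) is $d$-stratified for $d\colon V(G)\to\mathbb N$ if $t_u<_Tt_v$ implies $d(u)\le d(v)$, where $t_v$ is the node closest to the root whose piece contains $v$ and $<_T$ is the tree order with root smallest. $\mathrm{tw}(G,d)$ is the minimum width of a $d$-stratified tree decomposition of $G$, and $\mathrm{fotw}(\varphi):=\mathrm{tw}(G_\varphi,\mathrm{ead}_\varphi)$. *)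

theory Defs
  imports Complex_Main "HOL-Library.Sublist"
begin

section \<open>Formulae\<close>

datatype ('v, 'c) trm = Var 'v | Const 'c

text \<open>A relation symbol used with argument lists of different lengths stands for different
  symbols of a vocabulary, one for each arity.\<close>

datatype ('v, 'c, 'r) atom =
    Rel 'r "('v, 'c) trm list"
  | Equal "('v, 'c) trm" "('v, 'c) trm"

datatype quantifier = Exists | Forall

text \<open>Formulae in negation normal form: negation is applied to atoms only.\<close>

datatype ('v, 'c, 'r) fm =
    Atom "('v, 'c, 'r) atom"
  | NegAtom "('v, 'c, 'r) atom"
  | Conj "('v, 'c, 'r) fm" "('v, 'c, 'r) fm"
  | Disj "('v, 'c, 'r) fm" "('v, 'c, 'r) fm"
  | Quant quantifier 'v "('v, 'c, 'r) fm"

fun trm_vars :: "('v, 'c) trm \<Rightarrow> 'v set" where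
  "trm_vars (Var x) = {x}"
| "trm_vars (Const c) = {}"

fun atom_vars :: "('v, 'c, 'r) atom \<Rightarrow> 'v set" where
  "atom_vars (Rel R ts) = (\<Union>t\<in>set ts. trm_vars t)"
| "atom_vars (Equal s t) = trm_vars s \<union> trm_vars t"

fun atoms :: "('v, 'c, 'r) fm \<Rightarrow> ('v, 'c, 'r) atom set" where
  "atoms (Atom a) = {a}"
| "atoms (NegAtom a) = {a}"
| "atoms (Conj \<phi> \<psi>) = atoms \<phi> \<union> atoms \<psi>"
| "atoms (Disj \<phi> \<psi>) = atoms \<phi> \<union> atoms \<psi>"
| "atoms (Quant q x \<phi>) = atoms \<phi>"

fun quantified_list :: "('v, 'c, 'r) fm \<Rightarrow> 'v list" where
  "quantified_list (Atom a) = []"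
| "quantified_list (NegAtom a) = []"
| "quantified_list (Conj \<phi> \<psi>) = quantified_list \<phi> @ quantified_list \<psi>"
| "quantified_list (Disj \<phi> \<psi>) = quantified_list \<phi> @ quantified_list \<psi>"
| "quantified_list (Quant q x \<phi>) = x # quantified_list \<phi>"

definition bound_vars :: "('v, 'c, 'r) fm \<Rightarrow> 'v set" where
  "bound_vars \<phi> = set (quantified_list \<phi>)"

fun free_vars :: "('v, 'c, 'r) fm \<Rightarrow> 'v set" where
  "free_vars (Atom a) = atom_vars a"
| "free_vars (NegAtom a) = atom_vars a"
| "free_vars (Conj \<phi> \<psi>) = free_vars \<phi> \<union> free_vars \<psi>"
| "free_vars (Disj \<phi> \<psi>) = free_vars \<phi> \<union> free_vars \<psi>"
| "free_vars (Quant q x \<phi>) = free_vars \<phi> - {x}"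

definition vars :: "('v, 'c, 'r) fm \<Rightarrow> 'v set" where
  "vars \<phi> = free_vars \<phi> \<union> bound_vars \<phi>"

definition straight :: "('v, 'c, 'r) fm \<Rightarrow> bool" where
  "straight \<phi> \<longleftrightarrow>
     distinct (quantified_list \<phi>) \<and>
     free_vars \<phi> \<inter> bound_vars \<phi> = {} \<and>
     (\<forall>x\<in>bound_vars \<phi>. \<exists>a\<in>atoms \<phi>. x \<in> atom_vars a)"

text \<open>Subformulae are taken as occurrences: each is paired with its position, the path leading to
  it from the root of the syntax tree.  Thus, two occurrences of the same atom are told apart.
  A negated atom is one node, whose position serves as that of the atom in it.\<close>

fun occurrences :: "('v, 'c, 'r) fm \<Rightarrow> (nat list \<times> ('v, 'c, 'r) fm) set" where
  "occurrences (Atom a) = {([], Atom a)}"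
| "occurrences (NegAtom a) = {([], NegAtom a)}"
| "occurrences (Conj \<phi> \<psi>) = {([], Conj \<phi> \<psi>)}
     \<union> {(0 # p, \<chi>) |p \<chi>. (p, \<chi>) \<in> occurrences \<phi>}
     \<union> {(1 # p, \<chi>) |p \<chi>. (p, \<chi>) \<in> occurrences \<psi>}"
| "occurrences (Disj \<phi> \<psi>) = {([], Disj \<phi> \<psi>)}
     \<union> {(0 # p, \<chi>) |p \<chi>. (p, \<chi>) \<in> occurrences \<phi>}
     \<union> {(1 # p, \<chi>) |p \<chi>. (p, \<chi>) \<in> occurrences \<psi>}"
| "occurrences (Quant q x \<phi>) = {([], Quant q x \<phi>)}
     \<union> {(0 # p, \<chi>) |p \<chi>. (p, \<chi>) \<in> occurrences \<phi>}"

definition subformulae :: "('v, 'c, 'r) fm \<Rightarrow> ('v, 'c, 'r) fm set" where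
  "subformulae \<phi> = snd ` occurrences \<phi>"

text \<open>The quantifier and the scope of a bound variable are unique in straight formulae.\<close>

definition quantifier_of :: "('v, 'c, 'r) fm \<Rightarrow> 'v \<Rightarrow> quantifier" where
  "quantifier_of \<phi> x = (THE q. \<exists>\<psi>. Quant q x \<psi> \<in> subformulae \<phi>)"

definition scope :: "('v, 'c, 'r) fm \<Rightarrow> 'v \<Rightarrow> ('v, 'c, 'r) fm" where
  "scope \<phi> x = (THE \<psi>. \<exists>q. Quant q x \<psi> \<in> subformulae \<phi>)"

definition scope_le :: "('v, 'c, 'r) fm \<Rightarrow> 'v rel" where
  "scope_le \<phi> = {(x, y). x \<in> bound_vars \<phi> \<and> y \<in> bound_vars \<phi> \<and>
     (x = y \<or> y \<in> bound_vars (scope \<phi> x))}"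

definition atom_positions_using :: "('v, 'c, 'r) fm \<Rightarrow> 'v set \<Rightarrow> nat list set" where
  "atom_positions_using \<phi> X = {p. \<exists>a. ((p, Atom a) \<in> occurrences \<phi> \<or> (p, NegAtom a) \<in> occurrences \<phi>) \<and>
     atom_vars a \<inter> X \<noteq> {}}"

definition covers :: "('v, 'c, 'r) fm \<Rightarrow> 'v set \<Rightarrow> nat list \<Rightarrow> bool" where
  "covers \<phi> X p \<longleftrightarrow> (\<forall>q\<in>atom_positions_using \<phi> X. prefix p q)"

text \<open>The occurrence at \<open>q\<close> is a subformula of the one at \<open>p\<close> iff \<open>p\<close> is a prefix of \<open>q\<close>.  The
  minimal occurrence is unique whenever some atom uses a variable from \<open>X\<close>.\<close>

definition minimal_subformula :: "('v, 'c, 'r) fm \<Rightarrow> 'v set \<Rightarrow> ('v, 'c, 'r) fm" where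
  "minimal_subformula \<phi> X = (THE \<psi>. \<exists>p. (p, \<psi>) \<in> occurrences \<phi> \<and> covers \<phi> X p \<and>
     (\<forall>(q, \<chi>)\<in>occurrences \<phi>. covers \<phi> X q \<longrightarrow> prefix p q \<longrightarrow> q = p))"

definition entangled :: "'v rel \<Rightarrow> ('v, 'c, 'r) fm \<Rightarrow> 'v \<Rightarrow> 'v \<Rightarrow> bool" where
  "entangled R \<phi> x y \<longleftrightarrow>
     x \<in> vars (minimal_subformula \<phi> {z. (y, z) \<in> R}) \<and>
     y \<in> vars (minimal_subformula \<phi> {z. (x, z) \<in> R})"

definition alternation_closed :: "('v, 'c, 'r) fm \<Rightarrow> 'v rel \<Rightarrow> bool" where
  "alternation_closed \<phi> R \<longleftrightarrow>
     (\<forall>x y. (x, y) \<in> scope_le \<phi> \<longrightarrow> quantifier_of \<phi> x \<noteq> quantifier_of \<phi> y \<longrightarrow>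
        (\<exists>n z. z 0 = x \<and> z n = y \<and> (\<forall>i\<le>n. z i \<in> bound_vars \<phi>) \<and>
           (\<forall>i<n. entangled R \<phi> (z i) (z (Suc i)) \<and> ((x, z i) \<in> R \<or> (y, z i) \<in> R))) \<longrightarrow>
        (x, y) \<in> R)"

text \<open>The intersection is itself a member of the family, since for reflexive relations entanglement
  is monotone in the relation.  Hence it is the smallest one.\<close>

definition essential_le :: "('v, 'c, 'r) fm \<Rightarrow> 'v rel" where
  "essential_le \<phi> = \<Inter>{R. R \<subseteq> vars \<phi> \<times> vars \<phi> \<and> refl_on (vars \<phi>) R \<and> trans R \<and> alternation_closed \<phi> R}"

definition alternations :: "('v, 'c, 'r) fm \<Rightarrow> 'v list \<Rightarrow> nat" where
  "alternations \<phi> vs =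
     card {i. Suc i < length vs \<and> quantifier_of \<phi> (vs ! i) \<noteq> quantifier_of \<phi> (vs ! Suc i)}"

definition depth :: "('v, 'c, 'r) fm \<Rightarrow> 'v rel \<Rightarrow> 'v \<Rightarrow> nat" where
  "depth \<phi> R x = (if x \<in> bound_vars \<phi>
     then Max {alternations \<phi> vs + (if quantifier_of \<phi> (hd vs) = Exists then 1 else 2) |vs.
       vs \<noteq> [] \<and> last vs = x \<and> successively (\<lambda>u v. (u, v) \<in> R \<and> u \<noteq> v) vs}
     else 0)"

definition ead :: "('v, 'c, 'r) fm \<Rightarrow> 'v \<Rightarrow> nat" where
  "ead \<phi> = depth \<phi> (essential_le \<phi>)"

definition ad :: "('v, 'c, 'r) fm \<Rightarrow> 'v \<Rightarrow> nat" where
  "ad \<phi> = depth \<phi> (scope_le \<phi>)"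

section \<open>Stratified tree decompositions\<close>

text \<open>A graph is a pair of a vertex set and a set of two-element edges.\<close>

type_synonym 'v graph = "'v set \<times> 'v set set"

definition formula_graph :: "('v, 'c, 'r) fm \<Rightarrow> 'v graph" where
  "formula_graph \<phi> = (vars \<phi>, {{x, y} |x y. x \<noteq> y \<and>
     (x \<in> free_vars \<phi> \<and> y \<in> free_vars \<phi> \<or>
      (\<exists>a\<in>atoms \<phi>. x \<in> atom_vars a \<and> y \<in> atom_vars a))})"

text \<open>A finite rooted tree with nodes \<open>N\<close>, root \<open>r\<close> and edges \<open>F\<close> directed away from the root;
  the tree order is \<open>F\<^sup>*\<close> and its strict part is \<open>F\<^sup>+\<close>.\<close>

definition rooted_tree :: "'t set \<Rightarrow> 't rel \<Rightarrow> 't \<Rightarrow> bool" where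
  "rooted_tree N F r \<longleftrightarrow> finite N \<and> F \<subseteq> N \<times> N \<and> r \<in> N \<and>
     (\<forall>t\<in>N. (r, t) \<in> F\<^sup>*) \<and> (\<forall>s. (s, r) \<notin> F) \<and> (\<forall>t\<in>N - {r}. \<exists>!s. (s, t) \<in> F)"

definition tree_connected :: "'t rel \<Rightarrow> 't set \<Rightarrow> bool" where
  "tree_connected F S \<longleftrightarrow> (\<forall>s\<in>S. \<forall>t\<in>S. (s, t) \<in> ((F \<union> F\<inverse>) \<inter> S \<times> S)\<^sup>*)"

definition tree_decomposition ::
    "'v graph \<Rightarrow> 't set \<Rightarrow> 't rel \<Rightarrow> 't \<Rightarrow> ('t \<Rightarrow> 'v set) \<Rightarrow> bool" where
  "tree_decomposition G N F r B \<longleftrightarrow> rooted_tree N F r \<and>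
     (\<forall>t\<in>N. B t \<subseteq> fst G) \<and>
     (\<forall>v\<in>fst G. \<exists>t\<in>N. v \<in> B t) \<and>
     (\<forall>e\<in>snd G. \<exists>t\<in>N. e \<subseteq> B t) \<and>
     (\<forall>v\<in>fst G. tree_connected F {t\<in>N. v \<in> B t})"

definition root_distance :: "'t rel \<Rightarrow> 't \<Rightarrow> 't \<Rightarrow> nat" where
  "root_distance F r t = (LEAST n. (r, t) \<in> F ^^ n)"

definition top_node :: "'t set \<Rightarrow> 't rel \<Rightarrow> 't \<Rightarrow> ('t \<Rightarrow> 'v set) \<Rightarrow> 'v \<Rightarrow> 't" where
  "top_node N F r B v = (ARG_MIN (root_distance F r) t. t \<in> N \<and> v \<in> B t)"

definition stratified ::
    "'v graph \<Rightarrow> ('v \<Rightarrow> nat) \<Rightarrow> 't set \<Rightarrow> 't rel \<Rightarrow> 't \<Rightarrow> ('t \<Rightarrow> 'v set) \<Rightarrow> bool" where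
  "stratified G d N F r B \<longleftrightarrow> (\<forall>u\<in>fst G. \<forall>v\<in>fst G.
     (top_node N F r B u, top_node N F r B v) \<in> F\<^sup>+ \<longrightarrow> d u \<le> d v)"

definition width :: "'t set \<Rightarrow> ('t \<Rightarrow> 'v set) \<Rightarrow> int" where
  "width N B = int (Max ((\<lambda>t. card (B t)) ` N)) - 1"

text \<open>Every finite tree is isomorphic to one with natural numbers as nodes.  For a finite graph,
  the set of widths is nonempty (take a single node) and bounded below by \<open>-1\<close>, so the infimum
  is attained.\<close>

definition tw :: "'v graph \<Rightarrow> ('v \<Rightarrow> nat) \<Rightarrow> int" where
  "tw G d = Inf {width N B |(N :: nat set) F r B.
     tree_decomposition G N F r B \<and> stratified G d N F r B}"

definition fotw :: "('v, 'c, 'r) fm \<Rightarrow> int" where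
  "fotw \<phi> = tw (formula_graph \<phi>) (ead \<phi>)"

end

theory Submission
  imports Defs
begin

text \<open>
  Take an \<open>ad\<close>-stratified tree decomposition.  Order the variables by \<open>ad\<close> and, within equal \<open>ad\<close>, by
  the distance of their top nodes from the root (rank \<open>q\<close>); then sort this order stably by \<open>ead\<close>
  (rank \<open>p\<close>).  Eliminating the variables along \<open>p\<close> yields an \<open>ead\<close>-stratified decomposition whose bag at
  \<open>x\<close> consists of \<open>x\<close> and the lower boundary of the component \<open>C\<close> of \<open>x\<close> among the variables of rank at
  least \<open>p x\<close>.  This bag lies in the old bag at the top node of \<open>x\<close>, provided that \<open>x\<close> has minimal
  \<open>q\<close>-rank in \<open>C\<close> and the boundary has smaller \<open>q\<close>-rank.

  Variables in a common atom are comparable in the scope order, so \<open>C\<close> has a scope-minimal element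
  \<open>m\<close> below all of \<open>C\<close>.  By downward induction along the scope order, every essential predecessor of \<open>m\<close>
  is one of every element connected to \<open>m\<close> above \<open>m\<close>: the generating sequences for the essential order
  can be prolonged along such connections.  Hence \<open>ead\<close> is minimal at \<open>m\<close>.  Conversely, if no quantifier
  alternation separates two connected variables, essential predecessors of the upper one are passed
  on to the lower one.  Both facts together give the claim about \<open>q\<close>-ranks.
\<close>

section \<open>Tree decompositions and elimination orders\<close>

lemma rooted_tree_single_valued:
  assumes "rooted_tree N F r"
  shows "single_valued (F\<inverse>)"
  using assms unfolding rooted_tree_def single_valued_def
  by (metis DiffI SigmaD2 converse_iff singletonD subsetD)

lemma root_distance_Suc:
  assumes T: "rooted_tree N F r" and st: "(s, t) \<in> F"
  shows "root_distance F r t = Suc (root_distance F r s)"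
proof -
  have N: "s \<in> N" "t \<noteq> r" using T st unfolding rooted_tree_def by auto
  have "(r, s) \<in> F\<^sup>*" using T N unfolding rooted_tree_def by auto
  then have ex: "\<exists>n. (r, s) \<in> F ^^ n" by (rule rtrancl_imp_relpow)
  have iff: "(r, t) \<in> F ^^ Suc n \<longleftrightarrow> (r, s) \<in> F ^^ n" for n
    using rooted_tree_single_valued[OF T] st
    by (auto elim!: relcompE intro!: relcompI simp: single_valued_def)
  obtain n where "(r, t) \<in> F ^^ Suc n" using ex iff by blast
  then have "(LEAST n. (r, t) \<in> F ^^ n) = Suc (LEAST n. (r, t) \<in> F ^^ Suc n)"
    by (rule Least_Suc) (use N in auto)
  then show ?thesis unfolding root_distance_def iff .
qed

lemma root_distance_trancl:
  assumes "rooted_tree N F r" and "(s, t) \<in> F\<^sup>+"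
  shows "root_distance F r s < root_distance F r t"
  using assms(2) by induction (auto simp: root_distance_Suc[OF assms(1)])

lemma rooted_tree_comparable:
  assumes "rooted_tree N F r" and "(a, t) \<in> F\<^sup>*" and "(b, t) \<in> F\<^sup>*"
  shows "(a, b) \<in> F\<^sup>* \<or> (b, a) \<in> F\<^sup>*"
  using single_valued_confluent[OF rooted_tree_single_valued[OF assms(1)], of t a b] assms(2,3)
  by (auto simp: rtrancl_converse)

context
  fixes G :: "'v graph" and N :: "'t set" and F r B
  assumes td: "tree_decomposition G N F r B"
begin

private lemma tree: "rooted_tree N F r"
  using td unfolding tree_decomposition_def by blast

lemma top_node_props:
  assumes "v \<in> fst G"
  shows "top_node N F r B v \<in> N" and "v \<in> B (top_node N F r B v)"
    and "\<And>t. t \<in> N \<Longrightarrow> v \<in> B t \<Longrightarrow> root_distance F r (top_node N F r B v) \<le> root_distance F r t"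
proof -
  obtain t where "t \<in> N \<and> v \<in> B t" using td assms unfolding tree_decomposition_def by blast
  note * = arg_min_nat_lemma[of "\<lambda>t. t \<in> N \<and> v \<in> B t", OF this, of "root_distance F r"]
  show "top_node N F r B v \<in> N" "v \<in> B (top_node N F r B v)"
    "\<And>t. t \<in> N \<Longrightarrow> v \<in> B t \<Longrightarrow> root_distance F r (top_node N F r B v) \<le> root_distance F r t"
    using * unfolding top_node_def by auto
qed

lemma top_node_path:
  assumes v: "v \<in> fst G" and s: "s \<in> N" "v \<in> B s"
  shows "(top_node N F r B v, s) \<in> (F \<inter> {t\<in>N. v \<in> B t} \<times> {t\<in>N. v \<in> B t})\<^sup>*"
proof -
  let ?S = "{t\<in>N. v \<in> B t}" and ?t = "top_node N F r B v"
  have "(?t, s) \<in> ((F \<union> F\<inverse>) \<inter> ?S \<times> ?S)\<^sup>*"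
    using td v s top_node_props(1,2)[OF v] unfolding tree_decomposition_def tree_connected_def by blast
  then show ?thesis
  proof induction
    case (step y z)
    show ?case
    proof (cases "(y, z) \<in> F")
      case True
      then show ?thesis using step by (auto intro: rtrancl_into_rtrancl)
    next
      case False
      then have zy: "(z, y) \<in> F" and z: "z \<in> ?S" using step by auto
      from step.IH show ?thesis
      proof (cases rule: rtranclE)
        case base
        then have "root_distance F r ?t = Suc (root_distance F r z)"
          using root_distance_Suc[OF tree zy] by simp
        then show ?thesis using top_node_props(3)[OF v, of z] z by auto
      next
        case (step w)
        then have "w = z"
          using zy rooted_tree_single_valued[OF tree] unfolding single_valued_def by blast
        then show ?thesis using step by simp
      qed
    qed
  qed simp
qed

lemma top_node_ancestor:
  assumes "v \<in> fst G" and "s \<in> N" "v \<in> B s"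
  shows "(top_node N F r B v, s) \<in> F\<^sup>*"
  using top_node_path[OF assms] by (rule rtrancl_mono[THEN subsetD, rotated]) auto

lemma bag_convex:
  assumes v: "v \<in> fst G" and s: "s \<in> N" "v \<in> B s"
    and b: "(top_node N F r B v, b) \<in> F\<^sup>*" "(b, s) \<in> F\<^sup>*"
  shows "v \<in> B b"
  using top_node_path[OF v s] b(2)
proof induction
  case base
  then have "b = top_node N F r B v"
    using b(1) root_distance_trancl[OF tree] by (metis less_asym rtranclD)
  then show ?case using top_node_props[OF v] by simp
next
  case (step y z)
  from step.prems show ?case
  proof (cases rule: rtranclE)
    case base
    then show ?thesis using step by simp
  next
    case (step w)
    then have "w = y"
      using \<open>(y, z) \<in> _\<close> rooted_tree_single_valued[OF tree] unfolding single_valued_def by blast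
    then show ?thesis using step step.IH \<open>(b, y) \<in> F\<^sup>* \<Longrightarrow> v \<in> B b\<close> by simp
  qed
qed

lemma boundary_in_top_bag:
  assumes x: "x \<in> fst G"
    and E: "\<And>a b. (a, b) \<in> E \<Longrightarrow> {a, b} \<in> snd G \<and> a \<in> fst G \<and> b \<in> fst G"
    and c: "(x, c) \<in> (E \<inter> C \<times> C)\<^sup>*"
    and above: "\<And>c. (x, c) \<in> (E \<inter> C \<times> C)\<^sup>* \<Longrightarrow> (top_node N F r B c, top_node N F r B x) \<notin> F\<^sup>+"
    and u: "(c, u) \<in> E" "(top_node N F r B x, top_node N F r B u) \<notin> F\<^sup>+"
  shows "u \<in> B (top_node N F r B x)"
proof -
  let ?t = "top_node N F r B"
  have edge: "\<exists>s. (?t a, s) \<in> F\<^sup>* \<and> (?t b, s) \<in> F\<^sup>* \<and> s \<in> N \<and> b \<in> B s" if ab: "(a, b) \<in> E" for a b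
  proof -
    obtain s where "s \<in> N" "{a, b} \<subseteq> B s"
      using td E[OF ab] unfolding tree_decomposition_def by blast
    then show ?thesis using top_node_ancestor E[OF ab] by (intro exI[of _ s]) auto
  qed
  have below: "(?t x, ?t c) \<in> F\<^sup>*"
    using c
  proof induction
    case (step y z)
    then obtain s where s: "(?t y, s) \<in> F\<^sup>*" "(?t z, s) \<in> F\<^sup>*" using edge by blast
    then have "(?t x, s) \<in> F\<^sup>*" using step by simp
    then show ?case
      using rooted_tree_comparable[OF tree _ s(2)] above[of z] step
      by (metis rtranclD rtrancl.rtrancl_into_rtrancl rtrancl.rtrancl_refl)
  qed simp
  obtain s where s: "(?t c, s) \<in> F\<^sup>*" "(?t u, s) \<in> F\<^sup>*" "s \<in> N" "u \<in> B s"
    using edge[OF u(1)] by blast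
  then have xs: "(?t x, s) \<in> F\<^sup>*" using below by simp
  then have "(?t u, ?t x) \<in> F\<^sup>*"
    using rooted_tree_comparable[OF tree _ s(2)] u(2) by (metis rtranclD rtrancl.rtrancl_refl)
  then show ?thesis using bag_convex[OF _ s(3,4) _ xs] E[OF u(1)] by blast
qed

end

definition upper_component :: "'v rel \<Rightarrow> ('v \<Rightarrow> nat) \<Rightarrow> 'v \<Rightarrow> 'v set" where
  "upper_component E p x = {c. (x, c) \<in> (E \<inter> {v. p x \<le> p v} \<times> {v. p x \<le> p v})\<^sup>*}"

definition lower_boundary :: "'v rel \<Rightarrow> ('v \<Rightarrow> nat) \<Rightarrow> 'v \<Rightarrow> 'v set" where
  "lower_boundary E p x = {u. p u < p x \<and> (\<exists>c\<in>upper_component E p x. (c, u) \<in> E)}"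

lemma upper_component_mono:
  assumes "sym E" and "y \<in> lower_boundary E p x"
  shows "upper_component E p x \<subseteq> upper_component E p y"
proof
  fix z assume z: "z \<in> upper_component E p x"
  let ?E = "\<lambda>x. E \<inter> {v. p x \<le> p v} \<times> {v. p x \<le> p v}"
  have yx: "p y < p x" using assms unfolding lower_boundary_def by simp
  then have sub: "(?E x)\<^sup>* \<subseteq> (?E y)\<^sup>*" by (intro rtrancl_mono) auto
  obtain c where c: "(x, c) \<in> (?E x)\<^sup>*" "(c, y) \<in> E"
    using assms unfolding lower_boundary_def upper_component_def by blast
  have "p x \<le> p c" using c(1) by induction auto
  then have "(y, c) \<in> ?E y" using c(2) yx assms(1) by (auto dest: symD)
  moreover have "(c, x) \<in> (?E y)\<^sup>*"
  proof -
    have "sym (?E y)" using assms(1) by (auto simp: sym_def)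
    then show ?thesis using c(1) sub by (meson subsetD symD sym_rtrancl)
  qed
  moreover have "(x, z) \<in> (?E y)\<^sup>*" using z sub unfolding upper_component_def by auto
  ultimately have "(y, z) \<in> (?E y)\<^sup>*" by (meson rtrancl_trans r_into_rtrancl)
  then show "z \<in> upper_component E p y" unfolding upper_component_def by simp
qed

lemma elimination_tree_decomposition:
  fixes G :: "'v graph" and p d :: "'v \<Rightarrow> nat"
  assumes fin: "finite (fst G)"
    and edges: "\<And>e. e \<in> snd G \<Longrightarrow> \<exists>u v. e = {u, v} \<and> (u, v) \<in> E"
    and E: "E \<subseteq> fst G \<times> fst G" "sym E" "irrefl E"
    and inj: "inj_on p (fst G)"
    and mono: "\<And>u v. u \<in> fst G \<Longrightarrow> v \<in> fst G \<Longrightarrow> p u < p v \<Longrightarrow> d u \<le> d v"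
  shows "\<exists>(N :: nat set) F r B. tree_decomposition G N F r B \<and> stratified G d N F r B \<and>
    (\<forall>t\<in>N. B t = {} \<or> (\<exists>x\<in>fst G. B t = insert x (lower_boundary E p x)))"
proof -
  define V where "V = fst G"
  define L where "L = lower_boundary E p"
  define par where "par x = (if L x = {} then 0 else Suc (Max (p ` L x)))" for x
  define N where "N = insert 0 ((\<lambda>x. Suc (p x)) ` V)"
  define F where "F = (\<lambda>x. (par x, Suc (p x))) ` V"
  define B where "B t = {u. \<exists>x\<in>V. t = Suc (p x) \<and> u \<in> insert x (L x)}" for t
  have LV: "L x \<subseteq> V" for x using E(1) unfolding L_def lower_boundary_def V_def by auto
  then have Lfin: "finite (L x)" for x using fin V_def finite_subset by blast
  have Llt: "p u < p x" if "u \<in> L x" for u x using that unfolding L_def lower_boundary_def by simp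
  have par_cases: "par x = 0 \<and> L x = {} \<or> (\<exists>y\<in>L x. par x = Suc (p y) \<and> (\<forall>u\<in>L x. p u \<le> p y))" for x
  proof (cases "L x = {}")
    case False
    then have "Max (p ` L x) \<in> p ` L x" using Lfin by (intro Max_in) auto
    then obtain y where "y \<in> L x" "Max (p ` L x) = p y" by auto
    then show ?thesis using False Lfin unfolding par_def by (auto intro!: bexI[of _ y] simp flip: \<open>_ = p y\<close>)
  qed (simp add: par_def)
  have par_le: "par x \<le> p x" for x
    using par_cases[of x] Llt[of _ x] by fastforce
  have parN: "par x \<in> N" for x using par_cases[of x] LV[of x] unfolding N_def by auto
  have Bnode: "B (Suc (p x)) = insert x (L x)" if "x \<in> V" for x
    using that inj unfolding B_def V_def by (auto dest: inj_onD)
  have B0: "B 0 = {}" unfolding B_def by simp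
  have reach: "(0, t) \<in> F\<^sup>*" if "t \<in> N" for t
    using that
  proof (induction t rule: less_induct)
    case (less t)
    show ?case
    proof (cases "t = 0")
      case False
      then obtain x where x: "x \<in> V" "t = Suc (p x)" using less unfolding N_def by auto
      then have "(0, par x) \<in> F\<^sup>*" using less.IH[of "par x"] par_le[of x] parN by simp
      moreover have "(par x, t) \<in> F" using x unfolding F_def by auto
      ultimately show ?thesis by (rule rtrancl_into_rtrancl)
    qed simp
  qed
  have tree: "rooted_tree N F 0"
    unfolding rooted_tree_def
  proof (intro conjI ballI allI)
    show "finite N" using fin unfolding N_def V_def by simp
    show "F \<subseteq> N \<times> N" using parN N_def unfolding F_def by blast
    show "\<exists>!s. (s, t) \<in> F" if "t \<in> N - {0}" for t
      using that inj unfolding F_def N_def V_def by (auto dest: inj_onD)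
  qed (use reach in \<open>auto simp: N_def F_def\<close>)
  have path: "(Suc (p v), Suc (p x)) \<in> (F \<inter> {t\<in>N. v \<in> B t} \<times> {t\<in>N. v \<in> B t})\<^sup>*"
    if "v \<in> V" "x \<in> V" "v \<in> insert x (L x)" for v x
    using that(2,3)
  proof (induction "p x" arbitrary: x rule: less_induct)
    case less
    show ?case
    proof (cases "v = x")
      case False
      then have v: "v \<in> L x" using less by simp
      then obtain y where y: "y \<in> L x" "par x = Suc (p y)" "\<forall>u\<in>L x. p u \<le> p y"
        using par_cases[of x] by auto
      have yV: "y \<in> V" using y LV by auto
      have vy: "v \<in> insert y (L y)"
      proof (cases "v = y")
        case False
        then have "p v < p y" using y v inj yV \<open>v \<in> V\<close> unfolding V_def
          by (metis inj_onD order_le_neq_trans)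
        moreover obtain c where "c \<in> upper_component E p x" "(c, v) \<in> E"
          using v unfolding L_def lower_boundary_def by auto
        moreover have "upper_component E p x \<subseteq> upper_component E p y"
          using upper_component_mono[OF E(2)] y unfolding L_def by simp
        ultimately show ?thesis unfolding L_def lower_boundary_def by auto
      qed simp
      have "(Suc (p v), Suc (p y)) \<in> (F \<inter> {t\<in>N. v \<in> B t} \<times> {t\<in>N. v \<in> B t})\<^sup>*"
        using less.hyps[OF Llt[OF y(1)] yV vy] .
      moreover have "(Suc (p y), Suc (p x)) \<in> F \<inter> {t\<in>N. v \<in> B t} \<times> {t\<in>N. v \<in> B t}"
      proof -
        have "(Suc (p y), Suc (p x)) \<in> F" using y(2) less.prems unfolding F_def by force
        moreover have "Suc (p y) \<in> N" "Suc (p x) \<in> N" using yV less.prems unfolding N_def by auto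
        ultimately show ?thesis using Bnode yV less.prems vy by auto
      qed
      ultimately show ?thesis by (rule rtrancl_into_rtrancl)
    qed simp
  qed
  have nodeE: "\<exists>x\<in>V. t = Suc (p x) \<and> v \<in> insert x (L x)" if "v \<in> B t" for v t
    using that unfolding B_def by auto
  have connected: "tree_connected F {t\<in>N. v \<in> B t}" if "v \<in> V" for v
    unfolding tree_connected_def
  proof (intro ballI)
    fix s t assume s: "s \<in> {t\<in>N. v \<in> B t}" and t: "t \<in> {t\<in>N. v \<in> B t}"
    let ?S = "{t\<in>N. v \<in> B t}"
    let ?F = "(F \<union> F\<inverse>) \<inter> ?S \<times> ?S"
    have sub: "(F \<inter> ?S \<times> ?S)\<^sup>* \<subseteq> ?F\<^sup>*" by (intro rtrancl_mono) auto
    have *: "(Suc (p v), t) \<in> ?F\<^sup>*" if "t \<in> ?S" for t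
      using path[OF \<open>v \<in> V\<close>] nodeE[of v t] that sub by blast
    have "sym ?F" by (auto simp: sym_def)
    then have "(s, Suc (p v)) \<in> ?F\<^sup>*" using *[OF s] by (meson symD sym_rtrancl)
    then show "(s, t) \<in> ?F\<^sup>*" using *[OF t] by (rule rtrancl_trans)
  qed
  have td: "tree_decomposition G N F 0 B"
    unfolding tree_decomposition_def V_def[symmetric]
  proof (intro conjI ballI)
    show "B t \<subseteq> V" if "t \<in> N" for t using LV unfolding B_def by auto
    show "\<exists>t\<in>N. v \<in> B t" if "v \<in> V" for v using Bnode that unfolding N_def by auto
    show "\<exists>t\<in>N. e \<subseteq> B t" if "e \<in> snd G" for e
    proof -
      have *: "\<exists>t\<in>N. {u, v} \<subseteq> B t" if uv: "(u, v) \<in> E" "p u < p v" for u v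
      proof -
        have "v \<in> upper_component E p v" unfolding upper_component_def by simp
        then have "u \<in> L v" using uv E(2) unfolding L_def lower_boundary_def by (auto dest: symD)
        moreover have "v \<in> V" using uv E(1) V_def by auto
        ultimately show ?thesis using Bnode unfolding N_def by auto
      qed
      obtain u v where e: "e = {u, v}" "(u, v) \<in> E" using edges \<open>e \<in> snd G\<close> by blast
      then have "u \<noteq> v" "u \<in> fst G" "v \<in> fst G" using E by (auto simp: irrefl_def)
      then have "p u \<noteq> p v" using inj by (auto dest: inj_onD)
      then show ?thesis using *[of u v] *[of v u] e E(2)
        by (metis insert_commute linorder_neqE_nat symD)
    qed
  qed (use tree connected in auto)
  have top: "top_node N F 0 B v = Suc (p v)" if "v \<in> V" for v
  proof -
    let ?t = "top_node N F 0 B v"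
    have v: "v \<in> fst G" using that V_def by simp
    note t = top_node_props[OF td v]
    obtain x where x: "x \<in> V" "?t = Suc (p x)" "v \<in> insert x (L x)" using nodeE t(2) by blast
    have "(Suc (p v), ?t) \<in> F\<^sup>*"
      using path[OF that x(1,3)] unfolding x(2) by (rule rtrancl_mono[THEN subsetD, rotated]) auto
    moreover have "Suc (p v) \<in> N" "v \<in> B (Suc (p v))" using Bnode that unfolding N_def by auto
    then have "root_distance F 0 ?t \<le> root_distance F 0 (Suc (p v))" using t(3) by blast
    ultimately show ?thesis using root_distance_trancl[OF tree] by (metis leD rtranclD)
  qed
  have "stratified G d N F 0 B"
    unfolding stratified_def V_def[symmetric]
  proof (intro ballI impI)
    fix u v assume uv: "u \<in> V" "v \<in> V" "(top_node N F 0 B u, top_node N F 0 B v) \<in> F\<^sup>+"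
    have "s < t" if "(s, t) \<in> F\<^sup>+" for s t
      using that
    proof induction
      case (base t)
      then show ?case using par_le by (auto simp: F_def less_Suc_eq_le)
    next
      case (step t w)
      then have "t < w" using par_le by (auto simp: F_def less_Suc_eq_le)
      then show ?case using step by simp
    qed
    then have "p u < p v" using uv top by fastforce
    then show "d u \<le> d v" using mono uv V_def by simp
  qed
  moreover have "B t = {} \<or> (\<exists>x\<in>fst G. B t = insert x (lower_boundary E p x))" if "t \<in> N" for t
    using that Bnode B0 unfolding N_def V_def L_def by auto
  ultimately show ?thesis using td by blast
qed

section \<open>Entanglement along a forest order\<close>

locale entanglement_forest =
  fixes A :: "'v set" and le R ent adj :: "'v rel" and Q :: "'v \<Rightarrow> 'q"
  assumes finite: "finite A"
    and le_sub: "le \<subseteq> A \<times> A" and le_refl: "x \<in> A \<Longrightarrow> (x, x) \<in> le"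
    and le_trans: "trans le" and le_antisym: "antisym le"
    and le_forest: "(x, z) \<in> le \<Longrightarrow> (y, z) \<in> le \<Longrightarrow> (x, y) \<in> le \<or> (y, x) \<in> le"
    and adj_sym: "sym adj" and adj_ent: "adj \<subseteq> ent"
    and adj_le: "(x, y) \<in> adj \<Longrightarrow> (x, y) \<in> le \<or> (y, x) \<in> le"
    and R_le: "R \<subseteq> le" and R_refl: "x \<in> A \<Longrightarrow> (x, x) \<in> R" and R_trans: "trans R"
    and R_step: "(x, y) \<in> le \<Longrightarrow> Q x \<noteq> Q y \<Longrightarrow>
      (x, y) \<in> {(a, b) \<in> ent. (x, a) \<in> R \<or> (y, a) \<in> R}\<^sup>* \<Longrightarrow> (x, y) \<in> R"
    and R_last: "(x, y) \<in> R \<Longrightarrow> x \<noteq> y \<Longrightarrow> \<exists>w. (x, w) \<in> R \<and> (w, y) \<in> R \<and> Q w \<noteq> Q y \<and>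
      (w, y) \<in> {(a, b) \<in> ent. (w, a) \<in> R}\<^sup>*"
begin

definition cone :: "'v \<Rightarrow> 'v set" where
  "cone d = {z. (d, z) \<in> (adj \<inter> {z. (d, z) \<in> le} \<times> {z. (d, z) \<in> le})\<^sup>*}"

definition linked :: "'v \<Rightarrow> 'v \<Rightarrow> bool" where
  "linked e d \<longleftrightarrow> (e, d) \<in> le \<and> e \<noteq> d \<and> (\<exists>z\<in>cone d. (e, z) \<in> adj)"

lemma le_transD: "(x, y) \<in> le \<Longrightarrow> (y, z) \<in> le \<Longrightarrow> (x, z) \<in> le"
  using le_trans by (rule transD)

lemma R_transD: "(x, y) \<in> R \<Longrightarrow> (y, z) \<in> R \<Longrightarrow> (x, z) \<in> R"
  using R_trans by (rule transD)

lemma cone_self [simp]: "d \<in> cone d"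
  unfolding cone_def by simp

lemma cone_le:
  assumes "d \<in> A" and "z \<in> cone d"
  shows "(d, z) \<in> le"
proof -
  have "(d, z) \<in> (adj \<inter> {z. (d, z) \<in> le} \<times> {z. (d, z) \<in> le})\<^sup>*"
    using assms(2) unfolding cone_def by simp
  then show ?thesis by cases (use le_refl assms in auto)
qed

lemma cone_step:
  assumes "d \<in> A" "y \<in> cone d" "(y, z) \<in> adj" "(d, z) \<in> le"
  shows "z \<in> cone d"
proof -
  have "(y, z) \<in> adj \<inter> {z. (d, z) \<in> le} \<times> {z. (d, z) \<in> le}"
    using assms cone_le by simp
  then show ?thesis using assms(2) unfolding cone_def by (auto intro: rtrancl_into_rtrancl)
qed

lemma cone_sym_path:
  "z \<in> cone d \<Longrightarrow> (z, d) \<in> (adj \<inter> {z. (d, z) \<in> le} \<times> {z. (d, z) \<in> le})\<^sup>*"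
proof -
  assume "z \<in> cone d"
  moreover have "sym (adj \<inter> {z. (d, z) \<in> le} \<times> {z. (d, z) \<in> le})"
    using adj_sym by (auto simp: sym_def)
  ultimately show ?thesis unfolding cone_def by (auto intro: symD[OF sym_rtrancl])
qed

lemma linked_cone_subset:
  assumes "linked e d"
  shows "cone d \<subseteq> cone e"
proof
  fix z assume z: "z \<in> cone d"
  have ed: "(e, d) \<in> le" "e \<in> A" "d \<in> A" using assms le_sub unfolding linked_def by auto
  obtain z' where z': "z' \<in> cone d" "(e, z') \<in> adj" using assms unfolding linked_def by auto
  have "z' \<in> cone e" using cone_step[OF ed(2) cone_self z'(2)] cone_le[OF ed(3) z'(1)] ed le_transD by blast
  have "(z', z) \<in> (adj \<inter> {z. (d, z) \<in> le} \<times> {z. (d, z) \<in> le})\<^sup>*"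
    using cone_sym_path[OF z'(1)] z unfolding cone_def by (simp add: rtrancl_trans)
  then show "z \<in> cone e"
  proof induction
    case (step y w)
    then show ?case using cone_step[of e y w] ed le_transD by blast
  qed (use \<open>z' \<in> cone e\<close> in simp)
qed

lemma linked_in_cone:
  assumes d: "d \<in> A" and z: "z \<in> cone d" "z \<noteq> d"
  shows "\<exists>e\<in>cone d. linked e z"
proof -
  have dz: "(d, z) \<in> le" using cone_le[OF d z(1)] .
  have zA: "z \<in> A" using dz le_sub by auto
  let ?E = "adj \<inter> {z. (d, z) \<in> le} \<times> {z. (d, z) \<in> le}"
  have "a \<in> cone z \<or> (\<exists>e. (a, e) \<in> ?E\<^sup>* \<and> linked e z)" if "(a, z) \<in> ?E\<^sup>*" for a
    using that
  proof (induction rule: converse_rtrancl_induct)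
    case (step a b)
    show ?case
    proof (cases "b \<in> cone z")
      case False
      then show ?thesis using step by (meson converse_rtrancl_into_rtrancl)
    next
      case True
      have zb: "(z, b) \<in> le" using cone_le[OF zA True] .
      have ab: "(a, b) \<in> adj" using step by auto
      have "(z, a) \<in> le \<or> (a, z) \<in> le" using adj_le[OF ab] zb le_forest le_transD by blast
      then show ?thesis
      proof (cases "(z, a) \<in> le")
        case True
        then show ?thesis using cone_step[OF zA \<open>b \<in> cone z\<close>] ab adj_sym by (blast dest: symD)
      next
        case False
        then have "linked a z"
          using \<open>(z, a) \<in> le \<or> (a, z) \<in> le\<close> True ab zA le_refl unfolding linked_def by blast
        then show ?thesis by blast
      qed
    qed
  qed simp
  from this[of d] have "d \<in> cone z \<or> (\<exists>e\<in>cone d. linked e z)" using z(1) unfolding cone_def by auto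
  moreover have "d \<notin> cone z"
    using cone_le[OF zA] dz z(2) le_antisym by (meson antisymD)
  ultimately show ?thesis by blast
qed

lemma wf_above: "wf {(y, x). (x, y) \<in> le \<and> x \<noteq> y}"
  and wf_below: "wf {(x, y). (x, y) \<in> le \<and> x \<noteq> y}"
proof -
  have fin: "finite {(x, y). (x, y) \<in> le \<and> x \<noteq> y}"
    using finite le_sub by (auto intro: finite_subset[of _ "A \<times> A"])
  have tr: "trans {(x, y). (x, y) \<in> le \<and> x \<noteq> y}"
    using le_trans le_antisym unfolding trans_def antisym_def by blast
  have acyc: "acyclic {(x, y). (x, y) \<in> le \<and> x \<noteq> y}"
    unfolding acyclic_def trancl_id[OF tr] by auto
  show "wf {(x, y). (x, y) \<in> le \<and> x \<noteq> y}" using finite_acyclic_wf[OF fin acyc] .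
  have "{(y, x). (x, y) \<in> le \<and> x \<noteq> y} = {(x, y). (x, y) \<in> le \<and> x \<noteq> y}\<inverse>" by auto
  then show "wf {(y, x). (x, y) \<in> le \<and> x \<noteq> y}" using finite_acyclic_wf_converse[OF fin acyc] by simp
qed

lemma le_minimal:
  assumes "x \<in> M"
  obtains m where "m \<in> M" "\<And>y. y \<in> M \<Longrightarrow> (y, m) \<in> le \<Longrightarrow> y = m"
  by (rule wfE_min[OF wf_below assms]) blast

lemma cone_induct [consumes 2, case_names base step]:
  assumes "d \<in> A" and "z \<in> cone d" and "P d"
    and "\<And>e z. e \<in> cone d \<Longrightarrow> z \<in> cone d \<Longrightarrow> z \<noteq> d \<Longrightarrow> linked e z \<Longrightarrow> P e \<Longrightarrow> P z"
  shows "P z"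
  using assms(2)
proof (induction z rule: wf_induct_rule[OF wf_below])
  case (1 z)
  show ?case
  proof (cases "z = d")
    case False
    then obtain e where "e \<in> cone d" "linked e z" using linked_in_cone assms(1) 1 by blast
    then show ?thesis using assms(4) 1 False unfolding linked_def by blast
  qed (use assms(3) in simp)
qed

lemma linked_via:
  assumes d: "d \<in> A" and z: "z \<in> cone d" "z \<noteq> d"
  shows "\<exists>m. z \<in> cone m \<and> linked d m"
proof -
  let ?M = "{m. (d, m) \<in> le \<and> m \<noteq> d \<and> z \<in> cone m \<and> m \<in> cone d}"
  have "z \<in> ?M" using cone_le[OF d z(1)] z by simp
  then obtain m where m: "m \<in> ?M" "\<And>m'. m' \<in> ?M \<Longrightarrow> (m', m) \<in> le \<Longrightarrow> m' = m"
    by (rule le_minimal) blast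
  then obtain e where e: "e \<in> cone d" "linked e m" using linked_in_cone[OF d, of m] by blast
  have "e = d"
  proof (rule ccontr)
    assume "e \<noteq> d"
    moreover have "z \<in> cone e" using linked_cone_subset[OF e(2)] m(1) by auto
    ultimately have "e \<in> ?M" using e cone_le[OF d] by auto
    then show False using m(2)[of e] e(2) unfolding linked_def by blast
  qed
  then show ?thesis using e m by auto
qed

abbreviation guarded :: "'v set \<Rightarrow> 'v rel" where
  "guarded W \<equiv> {(a, b) \<in> ent. a \<in> W}"

lemma guarded_mono: "W \<subseteq> W' \<Longrightarrow> (guarded W)\<^sup>* \<subseteq> (guarded W')\<^sup>*"
  by (intro rtrancl_mono) auto

lemma cone_guarded:
  assumes "m \<in> A" "y \<in> cone m" "z \<in> cone m"
  shows "(y, z) \<in> (guarded (cone m))\<^sup>*"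
proof -
  let ?E = "adj \<inter> {z. (m, z) \<in> le} \<times> {z. (m, z) \<in> le}"
  have "(y, m) \<in> ?E\<^sup>*" using cone_sym_path[OF assms(2)] .
  moreover have "(m, z) \<in> ?E\<^sup>*" using assms(3) unfolding cone_def by simp
  ultimately have "(y, z) \<in> ?E\<^sup>*" by simp
  then have "(y, z) \<in> (guarded (cone m))\<^sup>* \<and> z \<in> cone m"
  proof induction
    case (step a b)
    then have "(a, b) \<in> guarded (cone m)" using adj_ent by auto
    then show ?case using step cone_step[of m a b] assms(1) by (auto intro: rtrancl_into_rtrancl)
  qed (use assms(2) in simp)
  then show ?thesis by simp
qed

lemma linked_path:
  assumes "linked e d"
  shows "(e, d) \<in> adj \<or> (\<exists>m. linked e m \<and> linked d m \<and> (e, d) \<in> (guarded (insert e (cone m)))\<^sup>*)"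
proof (rule disjCI)
  assume no: "\<nexists>m. linked e m \<and> linked d m \<and> (e, d) \<in> (guarded (insert e (cone m)))\<^sup>*"
  obtain z where z: "z \<in> cone d" "(e, z) \<in> adj" and ed: "(e, d) \<in> le" "e \<noteq> d" "d \<in> A"
    using assms le_sub unfolding linked_def by auto
  have "z = d"
  proof (rule ccontr)
    assume "z \<noteq> d"
    then obtain m where m: "z \<in> cone m" "linked d m" using linked_via[OF ed(3) z(1)] by blast
    obtain z' where z': "z' \<in> cone m" "(d, z') \<in> adj" and dm: "(d, m) \<in> le" "d \<noteq> m" "m \<in> A"
      using m(2) le_sub unfolding linked_def by auto
    have "linked e m"
      using ed dm m(1) z(2) le_transD le_antisym unfolding linked_def by (meson antisymD)
    moreover have "(e, z) \<in> guarded (insert e (cone m))" using z adj_ent by auto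
    moreover have "(z, z') \<in> (guarded (insert e (cone m)))\<^sup>*"
      using cone_guarded[OF dm(3) m(1) z'(1)] guarded_mono[of "cone m" "insert e (cone m)"] by auto
    moreover have "(z', d) \<in> guarded (insert e (cone m))"
      using z' adj_ent adj_sym by (auto dest: symD)
    ultimately show False using no m(2)
      by (meson converse_rtrancl_into_rtrancl rtrancl_into_rtrancl)
  qed
  then show "(e, d) \<in> adj" using z by simp
qed

definition R_propagates :: "'v \<Rightarrow> bool" where
  "R_propagates d \<longleftrightarrow> (\<forall>e. linked e d \<longrightarrow>
     (Q e \<noteq> Q d \<longrightarrow> (e, d) \<in> R) \<and> (\<forall>y. (y, e) \<in> R \<longrightarrow> y \<noteq> e \<longrightarrow> (y, d) \<in> R))"

lemma R_cone_aux:
  assumes d: "d \<in> A" and up: "\<And>z. (d, z) \<in> le \<Longrightarrow> z \<noteq> d \<Longrightarrow> R_propagates z"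
    and z: "z \<in> cone d" and y: "(y, d) \<in> R" "y \<noteq> d"
  shows "(y, z) \<in> R"
  using d z
proof (induction rule: cone_induct)
  case (step e z)
  have "y \<noteq> e"
    using y R_le cone_le[OF d step(1)] le_antisym by (meson antisymD subsetD)
  moreover have "R_propagates z" using up cone_le[OF d step(2)] step(3) by auto
  ultimately show ?case using step unfolding R_propagates_def by blast
qed (use y in simp)

lemma propagate_same:
  assumes w: "(w, e) \<in> R" "(w, e) \<in> (guarded {a. (w, a) \<in> R})\<^sup>*"
    and ed: "(e, d) \<in> (guarded {a. (w, a) \<in> R})\<^sup>*"
    and wd: "(w, d) \<in> le" "Q w \<noteq> Q d"
  shows "(w, d) \<in> R"
proof (rule R_step[OF wd])
  have "(w, d) \<in> (guarded {a. (w, a) \<in> R})\<^sup>*" using w(2) ed by simp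
  then show "(w, d) \<in> {(a, b) \<in> ent. (w, a) \<in> R \<or> (d, a) \<in> R}\<^sup>*"
    by (rule rtrancl_mono[THEN subsetD, rotated]) auto
qed

lemma R_propagates: "R_propagates d"
proof (induction d rule: wf_induct_rule[OF wf_above])
  case (1 d)
  have above: "R_propagates z" if "(d, z) \<in> le" "z \<noteq> d" for z using 1 that by auto
  show ?case unfolding R_propagates_def
  proof (intro allI impI)
    fix e assume L: "linked e d"
    have ed: "(e, d) \<in> le" "e \<in> A" "d \<in> A" "e \<noteq> d" using L le_sub unfolding linked_def by auto
    have cone_m: "(y, z) \<in> R" if "linked d m" "(y, m) \<in> R" "y \<noteq> m" "z \<in> cone m" for y m z
    proof (rule R_cone_aux[OF _ _ that(4,2,3)])
      have dm: "(d, m) \<in> le" "d \<noteq> m" using that(1) unfolding linked_def by auto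
      then show "m \<in> A" using le_sub by auto
      show "R_propagates z" if "(m, z) \<in> le" "z \<noteq> m" for z
        using above[of z] dm that le_transD le_antisym by (metis antisymD)
    qed
    have prop_m: "R_propagates m" if "linked d m" for m
      using that above[of m] unfolding linked_def by auto
    have diff: "(e, d) \<in> R" if Q: "Q e \<noteq> Q d"
    proof (rule R_step[OF ed(1) Q])
      consider "(e, d) \<in> adj" |
        m where "linked e m" "linked d m" "(e, d) \<in> (guarded (insert e (cone m)))\<^sup>*"
        using linked_path[OF L] by blast
      then show "(e, d) \<in> {(a, b) \<in> ent. (e, a) \<in> R \<or> (d, a) \<in> R}\<^sup>*"
      proof cases
        case 1
        then show ?thesis using adj_ent R_refl ed by auto
      next
        case (2 m)
        obtain y where y: "y = e \<or> y = d" "Q y \<noteq> Q m" using Q by metis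
        then have "(y, m) \<in> R" "y \<noteq> m" using prop_m[OF 2(2)] 2 unfolding R_propagates_def by auto
        then have "\<forall>z\<in>cone m. (y, z) \<in> R" using cone_m 2(2) by blast
        then have "insert e (cone m) \<subseteq> {a. (e, a) \<in> R \<or> (d, a) \<in> R}"
          using y(1) R_refl ed(2) by blast
        then have "(e, d) \<in> (guarded {a. (e, a) \<in> R \<or> (d, a) \<in> R})\<^sup>*"
          by (rule guarded_mono[THEN subsetD, OF _ 2(3)])
        then show ?thesis by simp
      qed
    qed
    have same: "(y, d) \<in> R" if y: "(y, e) \<in> R" "y \<noteq> e" for y
    proof (cases "Q e = Q d")
      case False
      then show ?thesis using R_transD[OF y(1) diff] by blast
    next
      case True
      obtain w where w: "(y, w) \<in> R" "(w, e) \<in> R" "Q w \<noteq> Q e" "(w, e) \<in> (guarded {a. (w, a) \<in> R})\<^sup>*"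
        using R_last[OF y] by auto
      have "(e, d) \<in> (guarded {a. (w, a) \<in> R})\<^sup>*"
      proof -
        consider "(e, d) \<in> adj" |
          m where "linked e m" "linked d m" "(e, d) \<in> (guarded (insert e (cone m)))\<^sup>*"
          using linked_path[OF L] by blast
        then show ?thesis
        proof cases
          case 1
          then show ?thesis using adj_ent w(2) by auto
        next
          case (2 m)
          have "(w, m) \<in> R" using prop_m[OF 2(2)] 2(1) w(2,3) unfolding R_propagates_def by blast
          moreover have "w \<noteq> m"
            using w(2) R_le 2(1) le_antisym unfolding linked_def by (meson antisymD subsetD)
          ultimately have "insert e (cone m) \<subseteq> {a. (w, a) \<in> R}" using cone_m 2(2) w(2) by blast
          then show ?thesis by (rule guarded_mono[THEN subsetD, OF _ 2(3)])
        qed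
      qed
      moreover have "(w, d) \<in> le" using w(2) R_le ed(1) le_transD by blast
      moreover have "Q w \<noteq> Q d" using w(3) True by simp
      ultimately have "(w, d) \<in> R" by (rule propagate_same[OF w(2,4)])
      then show ?thesis using R_transD[OF w(1)] by blast
    qed
    show "(Q e \<noteq> Q d \<longrightarrow> (e, d) \<in> R) \<and> (\<forall>y. (y, e) \<in> R \<longrightarrow> y \<noteq> e \<longrightarrow> (y, d) \<in> R)"
      using diff same by blast
  qed
qed

lemma R_cone: "d \<in> A \<Longrightarrow> z \<in> cone d \<Longrightarrow> (y, d) \<in> R \<Longrightarrow> y \<noteq> d \<Longrightarrow> (y, z) \<in> R"
  by (rule R_cone_aux) (auto intro: R_propagates)

end

locale depth_forest = entanglement_forest +
  fixes ed sd :: "'a \<Rightarrow> nat"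
  assumes ed_less: "(x, y) \<in> R \<Longrightarrow> Q x \<noteq> Q y \<Longrightarrow> ed x < ed y"
    and ed_le: "x \<in> A \<Longrightarrow> y \<in> A \<Longrightarrow> Q x = Q y \<Longrightarrow>
      (\<And>w. (w, x) \<in> R \<Longrightarrow> w \<noteq> x \<Longrightarrow> (w, y) \<in> R \<and> w \<noteq> y) \<Longrightarrow> ed x \<le> ed y"
    and sd_le: "(x, y) \<in> le \<Longrightarrow> sd x \<le> sd y"
    and sd_less: "(x, y) \<in> le \<Longrightarrow> Q x \<noteq> Q y \<Longrightarrow> sd x < sd y"
begin

lemma linked_ed:
  assumes L: "linked e d"
  shows "ed e \<le> ed d"
proof (cases "Q e = Q d")
  case True
  have *: "e \<in> A" "d \<in> A" "(e, d) \<in> le" "e \<noteq> d" using L le_sub unfolding linked_def by auto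
  show ?thesis
  proof (rule ed_le[OF *(1,2) True])
    fix w assume w: "(w, e) \<in> R" "w \<noteq> e"
    then show "(w, d) \<in> R \<and> w \<noteq> d"
      using R_propagates[of d] L * R_le le_antisym unfolding R_propagates_def
      by (meson antisymD subsetD)
  qed
next
  case False
  then show ?thesis using R_propagates[of d] L ed_less unfolding R_propagates_def by fastforce
qed

lemma cone_ed: "d \<in> A \<Longrightarrow> z \<in> cone d \<Longrightarrow> ed d \<le> ed z"
proof (induction rule: cone_induct)
  case (step e z)
  then show ?case using linked_ed[of e z] by simp
qed simp

lemma linked_ed_ge:
  assumes L: "linked e c" and sd: "sd e = sd c"
  shows "ed c \<le> ed e"
proof -
  have *: "e \<in> A" "c \<in> A" "(e, c) \<in> le" "e \<noteq> c" using L le_sub unfolding linked_def by auto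
  have Q: "Q e = Q c" using sd_less[OF *(3)] sd by auto
  obtain z where z: "z \<in> cone c" "(e, z) \<in> adj" using L unfolding linked_def by auto
  show ?thesis
  proof (rule ed_le[OF *(2,1) Q[symmetric]])
    fix y assume y: "(y, c) \<in> R" "y \<noteq> c"
    obtain w where w: "(y, w) \<in> R" "(w, c) \<in> R" "Q w \<noteq> Q c" "(w, c) \<in> (guarded {a. (w, a) \<in> R})\<^sup>*"
      using R_last[OF y] by auto
    have wc: "(w, c) \<in> le" using w(2) R_le by auto
    have "(e, w) \<notin> le"
      using sd_less[of e w] sd_less[OF wc] w(3) Q sd by auto
    then have we: "(w, e) \<in> le" using le_forest[OF wc *(3)] by blast
    have wne: "w \<noteq> e" using w(3) Q by auto
    have wcone: "cone c \<subseteq> {a. (w, a) \<in> R}" using R_cone[OF *(2) _ w(2)] w(3) by blast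
    have "(c, z) \<in> (guarded {a. (w, a) \<in> R})\<^sup>*"
      using cone_guarded[OF *(2) cone_self z(1)] guarded_mono[OF wcone] by blast
    moreover have "(z, e) \<in> guarded {a. (w, a) \<in> R}"
      using z wcone adj_ent adj_sym by (auto dest: symD)
    ultimately have "(c, e) \<in> (guarded {a. (w, a) \<in> R})\<^sup>*" by (rule rtrancl_into_rtrancl)
    then have "(w, e) \<in> R" using propagate_same[OF w(2,4) _ we] w(3) Q by simp
    moreover have "y \<noteq> e" using w(1) we wne R_le le_antisym by (meson antisymD subsetD)
    ultimately show "(y, e) \<in> R \<and> y \<noteq> e" using w(1) R_transD by blast
  qed
qed

lemma cone_ed_ge:
  assumes m: "m \<in> A" and "c \<in> cone m" and "sd c = sd m"
  shows "ed c \<le> ed m"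
  using assms
proof (induction rule: cone_induct)
  case (step e c)
  have "sd m \<le> sd e" using cone_le[OF m step(1)] sd_le by blast
  moreover have "sd e \<le> sd c" using step(4) sd_le unfolding linked_def by blast
  ultimately have "sd e = sd m" "sd e = sd c" using step.prems by auto
  then show ?case using step linked_ed_ge[of e c] by simp
qed simp

text \<open>The hypotheses say that \<open>p\<close> sorts by \<open>ed\<close> first and by \<open>q\<close> second, where \<open>q\<close> refines \<open>sd\<close>; the
  conclusions, that passing from \<open>q\<close> to \<open>p\<close> does not enlarge the boundary of an upper component.\<close>

lemma component_rank:
  fixes p q :: "'a \<Rightarrow> nat"
  assumes x: "x \<in> C" and CA: "C \<subseteq> A"
    and conn: "\<forall>c\<in>C. (x, c) \<in> (adj \<inter> C \<times> C)\<^sup>*"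
    and px: "\<forall>c\<in>C. p x \<le> p c"
    and q: "\<forall>u\<in>A. \<forall>v\<in>A. sd u < sd v \<longrightarrow> q u < q v"
    and p: "\<forall>u\<in>A. \<forall>v\<in>A. ed u < ed v \<longrightarrow> p u < p v"
    and pq: "\<forall>u\<in>A. \<forall>v\<in>A. ed u = ed v \<longrightarrow> (p u \<le> p v \<longleftrightarrow> q u \<le> q v)"
  shows "\<And>c. c \<in> C \<Longrightarrow> q x \<le> q c"
    and "\<And>c u. c \<in> C \<Longrightarrow> (c, u) \<in> adj \<Longrightarrow> u \<in> A \<Longrightarrow> p u < p x \<Longrightarrow> q u \<le> q x"
proof -
  note conn = conn[rule_format] and px = px[rule_format]
    and q = q[rule_format] and p = p[rule_format] and pq = pq[rule_format]
  obtain m where m: "m \<in> C" "\<And>m'. m' \<in> C \<Longrightarrow> (m', m) \<in> le \<Longrightarrow> m' = m"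
    using x by (rule le_minimal) blast
  have mA: "m \<in> A" using m CA by auto
  have symC: "sym ((adj \<inter> C \<times> C)\<^sup>*)" using adj_sym by (intro sym_rtrancl) (auto simp: sym_def)
  have cone: "c \<in> cone m" if c: "c \<in> C" for c
  proof -
    have "(m, c) \<in> (adj \<inter> C \<times> C)\<^sup>*" using conn m(1) c symC by (meson rtrancl_trans symD)
    then show ?thesis
    proof induction
      case (step y z)
      have yz: "(y, z) \<in> adj" "z \<in> C" using step by auto
      have "(m, y) \<in> le" using cone_le[OF mA step.IH] .
      then have "(m, z) \<in> le \<or> (z, m) \<in> le" using adj_le[OF yz(1)] le_forest le_transD by blast
      then have "(m, z) \<in> le" using m(2)[of z] yz(2) le_refl[OF mA] by blast
      then show ?case using cone_step[OF mA step.IH yz(1)] by blast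
    qed simp
  qed
  have xA: "x \<in> A" using x CA by auto
  have "ed x \<le> ed m" using px[OF m(1)] p[OF mA xA] by (meson leD leI)
  then have ed_xm: "ed x = ed m" using cone_ed[OF mA cone[OF x]] by simp
  then have "q x \<le> q m" using px[OF m(1)] pq[OF xA mA] by simp
  then have "sd x \<le> sd m" using q[OF mA xA] by (meson leD leI)
  then have sd_xm: "sd x = sd m" using sd_le[OF cone_le[OF mA cone[OF x]]] by simp
  show "q x \<le> q c" if c: "c \<in> C" for c
  proof -
    have cA: "c \<in> A" using c CA by auto
    have "sd m \<le> sd c" using sd_le[OF cone_le[OF mA cone[OF c]]] .
    then consider "sd x < sd c" | "sd c = sd m" using sd_xm by linarith
    then show ?thesis
    proof cases
      case 1
      then show ?thesis using q[OF xA cA] by simp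
    next
      case 2
      then have "ed c = ed x"
        using cone_ed_ge[OF mA cone[OF c]] cone_ed[OF mA cone[OF c]] ed_xm by simp
      then show ?thesis using pq[OF xA cA] px[OF c] by simp
    qed
  qed
  show "q u \<le> q x" if cu: "c \<in> C" "(c, u) \<in> adj" and u: "u \<in> A" "p u < p x" for c u
  proof -
    have "ed u \<le> ed x" using p[OF xA u(1)] u(2) by (meson less_asym leI)
    then consider "ed u = ed x" | "ed u < ed x" by linarith
    then show ?thesis
    proof cases
      case 1
      then show ?thesis using pq[OF u(1) xA] u(2) by simp
    next
      case 2
      have "(m, c) \<in> le" using cone_le[OF mA cone[OF cu(1)]] .
      then have "(m, u) \<in> le \<or> (u, m) \<in> le" using adj_le[OF cu(2)] le_forest le_transD by blast
      moreover have "(m, u) \<notin> le"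
      proof
        assume "(m, u) \<in> le"
        then have "u \<in> cone m" using cone_step[OF mA cone[OF cu(1)] cu(2)] by blast
        then show False using cone_ed[OF mA, of u] 2 ed_xm by simp
      qed
      ultimately have "linked u m"
        using cone[OF cu(1)] cu(2) adj_sym le_refl[OF mA] unfolding linked_def by (blast dest: symD)
      then have "sd u \<le> sd m" "sd u \<noteq> sd m"
        using sd_le linked_ed_ge[of u m] 2 ed_xm unfolding linked_def by auto
      then show ?thesis using q[OF u(1) xA] sd_xm by simp
    qed
  qed
qed

end

section \<open>Occurrences and the essential order of a straight formula\<close>

lemma occurrences_root: "([], \<phi>) \<in> occurrences \<phi>"
  by (cases \<phi>) auto

lemma occurrences_functional:
  "(p, \<chi>) \<in> occurrences \<phi> \<Longrightarrow> (p, \<chi>') \<in> occurrences \<phi> \<Longrightarrow> \<chi> = \<chi>'"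
  by (induction \<phi> arbitrary: p) auto

lemma occurrences_appendD:
  "(p @ q, \<chi>) \<in> occurrences \<phi> \<Longrightarrow> \<exists>\<psi>. (p, \<psi>) \<in> occurrences \<phi> \<and> (q, \<chi>) \<in> occurrences \<psi>"
proof (induction \<phi> arbitrary: p)
  case (Conj \<phi>1 \<phi>2)
  then show ?case
    by (cases p) (auto intro: exI[of _ "Conj \<phi>1 \<phi>2"])
next
  case (Disj \<phi>1 \<phi>2)
  then show ?case
    by (cases p) (auto intro: exI[of _ "Disj \<phi>1 \<phi>2"])
next
  case (Quant q x \<phi>)
  then show ?case
    by (cases p) (auto intro: exI[of _ "Quant q x \<phi>"])
qed auto

lemma occurrences_appendI:
  "(p, \<psi>) \<in> occurrences \<phi> \<Longrightarrow> (q, \<chi>) \<in> occurrences \<psi> \<Longrightarrow> (p @ q, \<chi>) \<in> occurrences \<phi>"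
  by (induction \<phi> arbitrary: p) auto

lemma bound_vars_simps [simp]:
  "bound_vars (Atom a) = {}" "bound_vars (NegAtom a) = {}"
  "bound_vars (Conj \<phi> \<psi>) = bound_vars \<phi> \<union> bound_vars \<psi>"
  "bound_vars (Disj \<phi> \<psi>) = bound_vars \<phi> \<union> bound_vars \<psi>"
  "bound_vars (Quant q x \<phi>) = insert x (bound_vars \<phi>)"
  unfolding bound_vars_def by auto

lemma bound_vars_iff_occurrences:
  "x \<in> bound_vars \<phi> \<longleftrightarrow> (\<exists>p q \<psi>. (p, Quant q x \<psi>) \<in> occurrences \<phi>)"
  by (induction \<phi>) (simp; blast)+

lemma quantifier_position_unique:
  assumes "distinct (quantified_list \<phi>)"
    and "(p, Quant q x \<psi>) \<in> occurrences \<phi>" and "(p', Quant q' x \<psi>') \<in> occurrences \<phi>"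
  shows "p = p'"
proof -
  have mem: "x \<in> set (quantified_list \<chi>)" if "(p, Quant q x \<psi>) \<in> occurrences \<chi>"
    for p q \<psi> and \<chi> :: "('a, 'b, 'c) fm"
    using that bound_vars_iff_occurrences unfolding bound_vars_def by metis
  show ?thesis using assms
    by (induction \<phi> arbitrary: p p') (auto dest: mem)
qed

lemma finite_atom_vars [simp]: "finite (atom_vars a)"
proof -
  have "finite (trm_vars t)" for t :: "('a, 'b) trm" by (cases t) auto
  then show ?thesis by (cases a) auto
qed

lemma finite_vars [simp]: "finite (vars \<phi>)" and finite_bound_vars [simp]: "finite (bound_vars \<phi>)"
proof -
  have "finite (free_vars \<phi>)" by (induction \<phi>) auto
  then show "finite (vars \<phi>)" unfolding vars_def bound_vars_def by simp
qed (simp add: bound_vars_def)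

lemma vars_occurrences: "(p, \<chi>) \<in> occurrences \<phi> \<Longrightarrow> vars \<chi> \<subseteq> vars \<phi>"
proof (induction \<phi> arbitrary: p)
  case (Conj \<phi>1 \<phi>2)
  then show ?case unfolding vars_def by (auto; blast)
next
  case (Disj \<phi>1 \<phi>2)
  then show ?case unfolding vars_def by (auto; blast)
next
  case (Quant q x \<phi>)
  then show ?case unfolding vars_def by (auto; blast)
qed auto

lemma atoms_position:
  "a \<in> atoms \<phi> \<Longrightarrow> \<exists>p. (p, Atom a) \<in> occurrences \<phi> \<or> (p, NegAtom a) \<in> occurrences \<phi>"
  by (induction \<phi>) (simp; blast)+

lemma free_vars_atoms: "x \<in> free_vars \<phi> \<Longrightarrow> \<exists>a\<in>atoms \<phi>. x \<in> atom_vars a"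
  by (induction \<phi>) auto

lemma atom_vars_subset: "a \<in> atoms \<phi> \<Longrightarrow> atom_vars a \<subseteq> vars \<phi>"
  unfolding vars_def by (induction \<phi>) auto

lemma quantified_above_lift:
  assumes "\<And>r \<chi>. (r, \<chi>) \<in> occurrences \<psi> \<Longrightarrow> (i # r, \<chi>) \<in> occurrences \<phi>"
    and "\<exists>r q \<chi>. (r, Quant q x \<chi>) \<in> occurrences \<psi> \<and> prefix r p"
  shows "\<exists>r q \<chi>. (r, Quant q x \<chi>) \<in> occurrences \<phi> \<and> prefix r (i # p)"
proof -
  obtain r q \<chi> where "(r, Quant q x \<chi>) \<in> occurrences \<psi>" "prefix r p" using assms(2) by blast
  then have "(i # r, Quant q x \<chi>) \<in> occurrences \<phi>" "prefix (i # r) (i # p)" using assms(1) by auto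
  then show ?thesis by blast
qed

lemma atom_var_quantified_above:
  "(p, Atom a) \<in> occurrences \<phi> \<or> (p, NegAtom a) \<in> occurrences \<phi> \<Longrightarrow> x \<in> atom_vars a \<Longrightarrow>
    x \<in> free_vars \<phi> \<or> (\<exists>r q \<psi>. (r, Quant q x \<psi>) \<in> occurrences \<phi> \<and> prefix r p)"
proof (induction \<phi> arbitrary: p)
  case (Conj \<phi>1 \<phi>2)
  then consider r where "p = 0 # r" "(r, Atom a) \<in> occurrences \<phi>1 \<or> (r, NegAtom a) \<in> occurrences \<phi>1"
    | r where "p = 1 # r" "(r, Atom a) \<in> occurrences \<phi>2 \<or> (r, NegAtom a) \<in> occurrences \<phi>2"
    by auto
  then show ?case
  proof cases
    case 1
    show ?thesis
      using Conj.IH(1)[OF 1(2) Conj.prems(2)] quantified_above_lift[of \<phi>1 0 "Conj \<phi>1 \<phi>2" x r]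
      unfolding 1(1) by auto
  next
    case 2
    show ?thesis
      using Conj.IH(2)[OF 2(2) Conj.prems(2)] quantified_above_lift[of \<phi>2 1 "Conj \<phi>1 \<phi>2" x r]
      unfolding 2(1) by auto
  qed
next
  case (Disj \<phi>1 \<phi>2)
  then consider r where "p = 0 # r" "(r, Atom a) \<in> occurrences \<phi>1 \<or> (r, NegAtom a) \<in> occurrences \<phi>1"
    | r where "p = 1 # r" "(r, Atom a) \<in> occurrences \<phi>2 \<or> (r, NegAtom a) \<in> occurrences \<phi>2"
    by auto
  then show ?case
  proof cases
    case 1
    show ?thesis
      using Disj.IH(1)[OF 1(2) Disj.prems(2)] quantified_above_lift[of \<phi>1 0 "Disj \<phi>1 \<phi>2" x r]
      unfolding 1(1) by auto
  next
    case 2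
    show ?thesis
      using Disj.IH(2)[OF 2(2) Disj.prems(2)] quantified_above_lift[of \<phi>2 1 "Disj \<phi>1 \<phi>2" x r]
      unfolding 2(1) by auto
  qed
next
  case (Quant q y \<phi>)
  then obtain r where r: "p = 0 # r" "(r, Atom a) \<in> occurrences \<phi> \<or> (r, NegAtom a) \<in> occurrences \<phi>"
    by auto
  show ?case
  proof (cases "x = y")
    case True
    have "([], Quant q y \<phi>) \<in> occurrences (Quant q y \<phi>)" by (rule occurrences_root)
    then show ?thesis using True Nil_prefix by blast
  next
    case False
    then show ?thesis
      using Quant.IH[OF r(2) Quant.prems(2)] quantified_above_lift[of \<phi> 0 "Quant q y \<phi>" x r]
      unfolding r(1) by auto
  qed
qed auto

definition quantifier_position :: "('v, 'c, 'r) fm \<Rightarrow> 'v \<Rightarrow> nat list" where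
  "quantifier_position \<phi> x = (THE p. \<exists>q \<psi>. (p, Quant q x \<psi>) \<in> occurrences \<phi>)"

lemma minimal_subformula_position:
  assumes "atom_positions_using \<phi> X \<noteq> {}"
  shows "(Longest_common_prefix (atom_positions_using \<phi> X), minimal_subformula \<phi> X) \<in> occurrences \<phi>"
proof -
  let ?P = "atom_positions_using \<phi> X"
  let ?l = "Longest_common_prefix ?P"
  obtain q where q: "q \<in> ?P" using assms by auto
  then obtain \<chi> where \<chi>: "(q, \<chi>) \<in> occurrences \<phi>" unfolding atom_positions_using_def by auto
  have cov: "covers \<phi> X ?l" unfolding covers_def by (simp add: Longest_common_prefix_prefix)
  have below: "prefix p ?l" if "covers \<phi> X p" for p
    using that assms unfolding covers_def by (simp add: Longest_common_prefix_max_prefix)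
  obtain s where "q = ?l @ s" using cov q unfolding covers_def by (auto elim: prefixE)
  then obtain \<psi> where \<psi>: "(?l, \<psi>) \<in> occurrences \<phi>" using \<chi> occurrences_appendD by blast
  have "minimal_subformula \<phi> X = \<psi>"
    unfolding minimal_subformula_def
  proof (rule the_equality)
    show "\<exists>p. (p, \<psi>) \<in> occurrences \<phi> \<and> covers \<phi> X p \<and>
        (\<forall>(q, \<chi>)\<in>occurrences \<phi>. covers \<phi> X q \<longrightarrow> prefix p q \<longrightarrow> q = p)"
      using \<psi> cov below by (intro exI[of _ ?l]) (auto simp: prefix_order.antisym)
  next
    fix \<psi>' assume "\<exists>p. (p, \<psi>') \<in> occurrences \<phi> \<and> covers \<phi> X p \<and>
        (\<forall>(q, \<chi>)\<in>occurrences \<phi>. covers \<phi> X q \<longrightarrow> prefix p q \<longrightarrow> q = p)"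
    then obtain p where p: "(p, \<psi>') \<in> occurrences \<phi>" "covers \<phi> X p"
      "\<forall>(q, \<chi>)\<in>occurrences \<phi>. covers \<phi> X q \<longrightarrow> prefix p q \<longrightarrow> q = p" by blast
    then have "?l = p" using \<psi> cov below by blast
    then show "\<psi>' = \<psi>" using p(1) \<psi> occurrences_functional by blast
  qed
  then show ?thesis using \<psi> by simp
qed

lemma vars_minimal_subformula_mono:
  assumes "X \<subseteq> Y" and "atom_positions_using \<phi> X \<noteq> {}"
  shows "vars (minimal_subformula \<phi> X) \<subseteq> vars (minimal_subformula \<phi> Y)"
proof -
  let ?P = "atom_positions_using \<phi>"
  have sub: "?P X \<subseteq> ?P Y" using assms(1) unfolding atom_positions_using_def by blast
  then have ne: "?P Y \<noteq> {}" using assms(2) by auto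
  have "prefix (Longest_common_prefix (?P Y)) (Longest_common_prefix (?P X))"
    using sub assms(2) by (intro Longest_common_prefix_max_prefix) (auto intro: Longest_common_prefix_prefix)
  then obtain s where "Longest_common_prefix (?P X) = Longest_common_prefix (?P Y) @ s"
    by (auto elim: prefixE)
  then obtain \<psi> where "(Longest_common_prefix (?P Y), \<psi>) \<in> occurrences \<phi>"
    "(s, minimal_subformula \<phi> X) \<in> occurrences \<psi>"
    using minimal_subformula_position[OF assms(2)] occurrences_appendD by metis
  then show ?thesis
    using minimal_subformula_position[OF ne] occurrences_functional vars_occurrences by metis
qed

lemma atom_vars_minimal_subformula:
  assumes "a \<in> atoms \<phi>" and "x \<in> atom_vars a" "x \<in> X"
  shows "atom_vars a \<subseteq> vars (minimal_subformula \<phi> X)"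
proof -
  let ?P = "atom_positions_using \<phi> X"
  obtain p where p: "(p, Atom a) \<in> occurrences \<phi> \<or> (p, NegAtom a) \<in> occurrences \<phi>"
    using atoms_position[OF assms(1)] by blast
  then have pP: "p \<in> ?P" using assms unfolding atom_positions_using_def by blast
  then obtain s where "p = Longest_common_prefix ?P @ s"
    using Longest_common_prefix_prefix by (metis prefixE)
  then obtain \<psi> where \<psi>: "(Longest_common_prefix ?P, \<psi>) \<in> occurrences \<phi>"
    "(s, Atom a) \<in> occurrences \<psi> \<or> (s, NegAtom a) \<in> occurrences \<psi>"
    using p occurrences_appendD by metis
  moreover have "(Longest_common_prefix ?P, minimal_subformula \<phi> X) \<in> occurrences \<phi>"
    using pP by (intro minimal_subformula_position) auto
  ultimately have "\<psi> = minimal_subformula \<phi> X" using occurrences_functional by metis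
  then show ?thesis using \<psi>(2) vars_occurrences unfolding vars_def by fastforce
qed

definition entangled_rel :: "('v, 'c, 'r) fm \<Rightarrow> 'v rel \<Rightarrow> 'v rel" where
  "entangled_rel \<phi> R = {(a, b). a \<in> bound_vars \<phi> \<and> b \<in> bound_vars \<phi> \<and> entangled R \<phi> a b}"

definition direct_rel :: "('v, 'c, 'r) fm \<Rightarrow> 'v rel \<Rightarrow> 'v rel" where
  "direct_rel \<phi> R = {(x, y) \<in> scope_le \<phi>. quantifier_of \<phi> x \<noteq> quantifier_of \<phi> y \<and>
     (x, y) \<in> {(a, b) \<in> entangled_rel \<phi> R. (x, a) \<in> R \<or> (y, a) \<in> R}\<^sup>*}"

lemma alternation_closed_iff: "alternation_closed \<phi> R \<longleftrightarrow> direct_rel \<phi> R \<subseteq> R"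
proof -
  have path: "(\<exists>n z. z 0 = x \<and> z n = y \<and> (\<forall>i\<le>n. z i \<in> bound_vars \<phi>) \<and>
      (\<forall>i<n. entangled R \<phi> (z i) (z (Suc i)) \<and> ((x, z i) \<in> R \<or> (y, z i) \<in> R))) \<longleftrightarrow>
      (x, y) \<in> {(a, b) \<in> entangled_rel \<phi> R. (x, a) \<in> R \<or> (y, a) \<in> R}\<^sup>*" (is "?L \<longleftrightarrow> _ \<in> ?E\<^sup>*")
    if "(x, y) \<in> scope_le \<phi>" for x y
  proof
    assume ?L
    then obtain n z where *: "z 0 = x" "z n = y" "\<forall>i\<le>n. z i \<in> bound_vars \<phi>"
      "\<forall>i<n. entangled R \<phi> (z i) (z (Suc i)) \<and> ((x, z i) \<in> R \<or> (y, z i) \<in> R)" by blast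
    then have "(x, y) \<in> ?E ^^ n"
      unfolding relpow_fun_conv entangled_rel_def by (intro exI[of _ z]) auto
    then show "(x, y) \<in> ?E\<^sup>*" by (rule relpow_imp_rtrancl)
  next
    assume "(x, y) \<in> ?E\<^sup>*"
    then obtain n where "(x, y) \<in> ?E ^^ n" using rtrancl_imp_relpow by blast
    then obtain z where z: "z 0 = x" "z n = y" "\<forall>i<n. (z i, z (Suc i)) \<in> ?E"
      unfolding relpow_fun_conv by blast
    have "z i \<in> bound_vars \<phi>" if "i \<le> n" for i
    proof (cases i)
      case 0
      then show ?thesis using z \<open>(x, y) \<in> scope_le \<phi>\<close> unfolding scope_le_def by auto
    next
      case (Suc j)
      then have "(z j, z i) \<in> ?E" using z(3) that by simp
      then show ?thesis unfolding entangled_rel_def by auto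
    qed
    then show ?L using z unfolding entangled_rel_def by (intro exI[of _ n] exI[of _ z]) auto
  qed
  have "alternation_closed \<phi> R \<longleftrightarrow> (\<forall>x y. (x, y) \<in> scope_le \<phi> \<longrightarrow>
      quantifier_of \<phi> x \<noteq> quantifier_of \<phi> y \<longrightarrow>
      (x, y) \<in> {(a, b) \<in> entangled_rel \<phi> R. (x, a) \<in> R \<or> (y, a) \<in> R}\<^sup>* \<longrightarrow> (x, y) \<in> R)"
    unfolding alternation_closed_def by (simp only: path cong: imp_cong)
  also have "\<dots> \<longleftrightarrow> direct_rel \<phi> R \<subseteq> R" unfolding direct_rel_def by (simp add: subset_iff) blast
  finally show ?thesis .
qed

definition closed_relations :: "('v, 'c, 'r) fm \<Rightarrow> 'v rel set" where
  "closed_relations \<phi> = {R. R \<subseteq> vars \<phi> \<times> vars \<phi> \<and> refl_on (vars \<phi>) R \<and> trans R \<and> alternation_closed \<phi> R}"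

lemma essential_le_eq: "essential_le \<phi> = \<Inter>(closed_relations \<phi>)"
  unfolding essential_le_def closed_relations_def ..

definition chains :: "'v rel \<Rightarrow> 'v \<Rightarrow> 'v list set" where
  "chains R x = {vs. vs \<noteq> [] \<and> last vs = x \<and> successively (\<lambda>u v. (u, v) \<in> R \<and> u \<noteq> v) vs}"

definition chain_depth :: "('v, 'c, 'r) fm \<Rightarrow> 'v list \<Rightarrow> nat" where
  "chain_depth \<phi> vs = alternations \<phi> vs + (if quantifier_of \<phi> (hd vs) = Exists then 1 else 2)"

lemma depth_eq: "x \<in> bound_vars \<phi> \<Longrightarrow> depth \<phi> R x = Max (chain_depth \<phi> ` chains R x)"
  unfolding depth_def chains_def chain_depth_def by (simp add: image_Collect)

lemma alternations_snoc:
  assumes "vs \<noteq> []"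
  shows "alternations \<phi> (vs @ [y]) =
    alternations \<phi> vs + (if quantifier_of \<phi> (last vs) \<noteq> quantifier_of \<phi> y then 1 else 0)"
proof -
  let ?Q = "quantifier_of \<phi>"
  let ?I = "\<lambda>vs. {i. Suc i < length vs \<and> ?Q (vs ! i) \<noteq> ?Q (vs ! Suc i)}"
  obtain n where n: "length vs = Suc n" using assms by (cases vs) auto
  have "?I (vs @ [y]) = ?I vs \<union> (if ?Q (last vs) \<noteq> ?Q y then {n} else {})"
    using n assms by (auto simp: nth_append last_conv_nth less_Suc_eq)
  moreover have "finite (?I vs)" "n \<notin> ?I vs"
    using n by (auto intro: finite_subset[of _ "{..n}"])
  ultimately show ?thesis unfolding alternations_def by simp
qed

lemma chain_depth_snoc:
  assumes "vs \<noteq> []"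
  shows "chain_depth \<phi> (vs @ [y]) =
    chain_depth \<phi> vs + (if quantifier_of \<phi> (last vs) \<noteq> quantifier_of \<phi> y then 1 else 0)"
  using alternations_snoc[OF assms, of \<phi> y] assms unfolding chain_depth_def by simp

lemma chains_snoc:
  assumes "vs \<in> chains R x" and "(x, y) \<in> R" "x \<noteq> y"
  shows "vs @ [y] \<in> chains R y"
  using assms unfolding chains_def by (auto simp: successively_append_iff)

definition atom_adjacent :: "('v, 'c, 'r) fm \<Rightarrow> 'v rel" where
  "atom_adjacent \<phi> = {(x, y). x \<in> bound_vars \<phi> \<and> y \<in> bound_vars \<phi> \<and>
     (\<exists>a\<in>atoms \<phi>. x \<in> atom_vars a \<and> y \<in> atom_vars a)}"

context
  fixes \<phi> :: "('v, 'c, 'r) fm"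
  assumes straight: "straight \<phi>"
begin

lemma distinct_quantified: "distinct (quantified_list \<phi>)"
  and free_not_bound: "x \<in> free_vars \<phi> \<Longrightarrow> x \<notin> bound_vars \<phi>"
  using straight unfolding straight_def by auto

lemma var_in_atom: "x \<in> vars \<phi> \<Longrightarrow> \<exists>a\<in>atoms \<phi>. x \<in> atom_vars a"
  using straight free_vars_atoms[of x \<phi>] unfolding straight_def vars_def by auto

lemma quantifier_position_eq:
  assumes "(p, Quant q x \<psi>) \<in> occurrences \<phi>"
  shows "quantifier_position \<phi> x = p"
  unfolding quantifier_position_def
  using assms quantifier_position_unique[OF distinct_quantified] by (intro the_equality) blast+

lemma scope_eq:
  assumes "(p, Quant q x \<psi>) \<in> occurrences \<phi>"
  shows "scope \<phi> x = \<psi>"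
proof -
  have uniq: "\<psi>' = \<psi>" if "(p', Quant q' x \<psi>') \<in> occurrences \<phi>" for p' q' \<psi>'
    using quantifier_position_unique[OF distinct_quantified assms that] occurrences_functional assms that
    by blast
  show ?thesis
    unfolding scope_def
  proof (rule the_equality)
    have "Quant q x \<psi> \<in> subformulae \<phi>"
      unfolding subformulae_def using image_eqI[OF _ assms, of _ snd] by simp
    then show "\<exists>q. Quant q x \<psi> \<in> subformulae \<phi>" ..
  qed (auto simp: subformulae_def dest: uniq)
qed

lemma scope_le_iff:
  "(x, y) \<in> scope_le \<phi> \<longleftrightarrow> x \<in> bound_vars \<phi> \<and> y \<in> bound_vars \<phi> \<and>
    prefix (quantifier_position \<phi> x) (quantifier_position \<phi> y)"
proof (cases "x \<in> bound_vars \<phi> \<and> y \<in> bound_vars \<phi>")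
  case True
  obtain p q \<psi> where x: "(p, Quant q x \<psi>) \<in> occurrences \<phi>"
    using True bound_vars_iff_occurrences[of x] by blast
  obtain p' q' \<psi>' where y: "(p', Quant q' y \<psi>') \<in> occurrences \<phi>"
    using True bound_vars_iff_occurrences[of y] by blast
  have "x = y \<or> y \<in> bound_vars \<psi> \<longleftrightarrow> prefix p p'"
  proof
    assume "x = y \<or> y \<in> bound_vars \<psi>"
    then show "prefix p p'"
    proof
      assume "x = y"
      then show ?thesis using quantifier_position_unique[OF distinct_quantified] x y by blast
    next
      assume "y \<in> bound_vars \<psi>"
      then obtain s q'' \<psi>'' where "(s, Quant q'' y \<psi>'') \<in> occurrences \<psi>"
        using bound_vars_iff_occurrences by metis
      then have "(p @ 0 # s, Quant q'' y \<psi>'') \<in> occurrences \<phi>"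
        using occurrences_appendI[OF x] by auto
      then show ?thesis using quantifier_position_unique[OF distinct_quantified y] by auto
    qed
  next
    assume "prefix p p'"
    then obtain s where "p' = p @ s" by (auto elim: prefixE)
    then have "(s, Quant q' y \<psi>') \<in> occurrences (Quant q x \<psi>)"
      using occurrences_appendD y occurrences_functional[OF x] by blast
    then show "x = y \<or> y \<in> bound_vars \<psi>" using bound_vars_iff_occurrences[of y \<psi>] by auto
  qed
  then show ?thesis
    using True scope_eq[OF x] quantifier_position_eq[OF x] quantifier_position_eq[OF y]
    unfolding scope_le_def by simp
qed (auto simp: scope_le_def)

lemma scope_le_antisym: "antisym (scope_le \<phi>)"
proof (rule antisymI)
  fix x y assume "(x, y) \<in> scope_le \<phi>" "(y, x) \<in> scope_le \<phi>"
  then have *: "x \<in> bound_vars \<phi>" "y \<in> bound_vars \<phi>" "quantifier_position \<phi> x = quantifier_position \<phi> y"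
    unfolding scope_le_iff by (auto simp: prefix_order.antisym)
  obtain p q \<psi> where x: "(p, Quant q x \<psi>) \<in> occurrences \<phi>"
    using * bound_vars_iff_occurrences[of x] by blast
  obtain p' q' \<psi>' where y: "(p', Quant q' y \<psi>') \<in> occurrences \<phi>"
    using * bound_vars_iff_occurrences[of y] by blast
  have "p = p'" using * quantifier_position_eq[OF x] quantifier_position_eq[OF y] by simp
  then show "x = y" using x y occurrences_functional by blast
qed

lemma scope_le_trans: "trans (scope_le \<phi>)"
  by (rule transI) (auto simp: scope_le_iff dest: prefix_order.trans)

lemma atom_comparable:
  assumes a: "a \<in> atoms \<phi>" "x \<in> atom_vars a" "y \<in> atom_vars a"
    and b: "x \<in> bound_vars \<phi>" "y \<in> bound_vars \<phi>"
  shows "(x, y) \<in> scope_le \<phi> \<or> (y, x) \<in> scope_le \<phi>"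
proof -
  obtain p where p: "(p, Atom a) \<in> occurrences \<phi> \<or> (p, NegAtom a) \<in> occurrences \<phi>"
    using atoms_position[OF a(1)] by blast
  have "prefix (quantifier_position \<phi> z) p" if "z \<in> atom_vars a" "z \<in> bound_vars \<phi>" for z
    using atom_var_quantified_above[OF p that(1)] free_not_bound that(2) quantifier_position_eq by blast
  then show ?thesis using a b prefix_same_cases unfolding scope_le_iff by blast
qed

lemma entangled_mono:
  assumes "R \<subseteq> S" and "refl_on (vars \<phi>) R" and "x \<in> vars \<phi>" "y \<in> vars \<phi>" and "entangled R \<phi> x y"
  shows "entangled S \<phi> x y"
proof -
  have "vars (minimal_subformula \<phi> {z. (v, z) \<in> R}) \<subseteq> vars (minimal_subformula \<phi> {z. (v, z) \<in> S})"
    if v: "v \<in> vars \<phi>" for v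
  proof (rule vars_minimal_subformula_mono)
    obtain a where a: "a \<in> atoms \<phi>" "v \<in> atom_vars a" using var_in_atom[OF v] by blast
    obtain p where "(p, Atom a) \<in> occurrences \<phi> \<or> (p, NegAtom a) \<in> occurrences \<phi>"
      using atoms_position[OF a(1)] by blast
    moreover have "(v, v) \<in> R" using assms(2) v by (auto dest: refl_onD)
    ultimately show "atom_positions_using \<phi> {z. (v, z) \<in> R} \<noteq> {}"
      using a(2) unfolding atom_positions_using_def by blast
  qed (use assms(1) in auto)
  then show ?thesis using assms unfolding entangled_def by blast
qed

lemma direct_rel_mono:
  assumes "R \<subseteq> S" and "refl_on (vars \<phi>) R"
  shows "direct_rel \<phi> R \<subseteq> direct_rel \<phi> S"
proof -
  have "entangled_rel \<phi> R \<subseteq> entangled_rel \<phi> S"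
    using entangled_mono[OF assms] unfolding entangled_rel_def vars_def by auto
  then have "{(a, b) \<in> entangled_rel \<phi> R. (x, a) \<in> R \<or> (y, a) \<in> R}\<^sup>* \<subseteq>
      {(a, b) \<in> entangled_rel \<phi> S. (x, a) \<in> S \<or> (y, a) \<in> S}\<^sup>*" for x y
    using assms(1) by (intro rtrancl_mono) auto
  then show ?thesis unfolding direct_rel_def by auto
qed

lemma scope_le_closed: "scope_le \<phi> \<union> Id_on (vars \<phi>) \<in> closed_relations \<phi>"
  unfolding closed_relations_def mem_Collect_eq
proof (intro conjI)
  show "scope_le \<phi> \<union> Id_on (vars \<phi>) \<subseteq> vars \<phi> \<times> vars \<phi>"
    unfolding scope_le_def vars_def by auto
  show "trans (scope_le \<phi> \<union> Id_on (vars \<phi>))"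
    by (rule transI) (auto dest: transD[OF scope_le_trans])
qed (auto simp: refl_on_def alternation_closed_iff direct_rel_def)

lemma essential_le_closed: "essential_le \<phi> \<in> closed_relations \<phi>"
  unfolding closed_relations_def mem_Collect_eq
proof (intro conjI)
  show "essential_le \<phi> \<subseteq> vars \<phi> \<times> vars \<phi>"
    using scope_le_closed unfolding essential_le_eq closed_relations_def by blast
  show refl: "refl_on (vars \<phi>) (essential_le \<phi>)"
    unfolding essential_le_eq closed_relations_def refl_on_def by auto
  show "trans (essential_le \<phi>)"
    unfolding essential_le_eq closed_relations_def trans_def by blast
  have "direct_rel \<phi> (essential_le \<phi>) \<subseteq> R" if R: "R \<in> closed_relations \<phi>" for R
  proof -
    have "direct_rel \<phi> (essential_le \<phi>) \<subseteq> direct_rel \<phi> R"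
      using R refl by (intro direct_rel_mono) (auto simp: essential_le_eq)
    then show ?thesis using R unfolding closed_relations_def alternation_closed_iff by blast
  qed
  then show "alternation_closed \<phi> (essential_le \<phi>)"
    unfolding alternation_closed_iff essential_le_eq by blast
qed

lemma essential_le_props:
  shows "essential_le \<phi> \<subseteq> vars \<phi> \<times> vars \<phi>" "refl_on (vars \<phi>) (essential_le \<phi>)"
    "trans (essential_le \<phi>)" "direct_rel \<phi> (essential_le \<phi>) \<subseteq> essential_le \<phi>"
  using essential_le_closed unfolding closed_relations_def alternation_closed_iff by auto

lemma essential_le_scope_le: "(x, y) \<in> essential_le \<phi> \<Longrightarrow> x \<noteq> y \<Longrightarrow> (x, y) \<in> scope_le \<phi>"
  using scope_le_closed unfolding essential_le_eq by blast

lemma essential_le_direct: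
  "essential_le \<phi> \<subseteq> (direct_rel \<phi> (essential_le \<phi>))\<^sup>*"
proof -
  let ?D = "direct_rel \<phi> (essential_le \<phi>)"
  let ?S = "?D\<^sup>* \<inter> vars \<phi> \<times> vars \<phi>"
  have SE: "?S \<subseteq> essential_le \<phi>"
  proof clarify
    fix x y assume "(x, y) \<in> ?D\<^sup>*" "x \<in> vars \<phi>"
    then show "(x, y) \<in> essential_le \<phi>"
    proof (induction rule: rtrancl_induct)
      case base
      then show ?case using essential_le_props(2) by (auto dest: refl_onD)
    next
      case (step y z)
      then show ?case using essential_le_props(3,4) by (blast dest: transD)
    qed
  qed
  have refl: "refl_on (vars \<phi>) ?S" by (auto simp: refl_on_def)
  have "direct_rel \<phi> ?S \<subseteq> ?D" using direct_rel_mono[OF SE refl] .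
  moreover have "direct_rel \<phi> ?S \<subseteq> vars \<phi> \<times> vars \<phi>"
    unfolding direct_rel_def scope_le_def vars_def by auto
  ultimately have "alternation_closed \<phi> ?S" unfolding alternation_closed_iff by auto
  moreover have "trans ?S" by (auto simp: trans_def intro: rtrancl_trans)
  ultimately have "?S \<in> closed_relations \<phi>" using refl unfolding closed_relations_def by simp
  then show ?thesis unfolding essential_le_eq by blast
qed

lemma essential_le_last:
  assumes "(x, y) \<in> essential_le \<phi>" and "x \<noteq> y"
  shows "\<exists>w. (x, w) \<in> essential_le \<phi> \<and> (w, y) \<in> direct_rel \<phi> (essential_le \<phi>)"
proof -
  have "(x, y) \<in> (direct_rel \<phi> (essential_le \<phi>))\<^sup>*" using assms essential_le_direct by blast
  then obtain w where w: "(x, w) \<in> (direct_rel \<phi> (essential_le \<phi>))\<^sup>*" "(w, y) \<in> direct_rel \<phi> (essential_le \<phi>)"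
    using assms(2) by (auto elim: rtranclE)
  have "(x, w) \<in> (essential_le \<phi>)\<^sup>*" using w(1) rtrancl_mono[OF essential_le_props(4)] by blast
  then have "(x, w) \<in> essential_le \<phi>"
    using essential_le_props(2,3) assms(1) essential_le_props(1)
    by (metis SigmaD1 refl_onD rtranclD subsetD trancl_id)
  then show ?thesis using w(2) by blast
qed

lemma finite_chains:
  assumes "\<And>u v. (u, v) \<in> R \<Longrightarrow> u \<noteq> v \<Longrightarrow> (u, v) \<in> scope_le \<phi>"
  shows "finite (chains R x)"
proof -
  let ?A = "insert x (bound_vars \<phi>)"
  let ?P = "\<lambda>u v. (u, v) \<in> scope_le \<phi> \<and> u \<noteq> v"
  have tr: "transp ?P"
    using scope_le_trans scope_le_antisym unfolding transp_def trans_def antisym_def by blast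
  have "set vs \<subseteq> ?A \<and> length vs \<le> card ?A" if vs: "vs \<in> chains R x" for vs
  proof -
    have sorted: "sorted_wrt ?P vs"
      using vs assms unfolding chains_def successively_conv_sorted_wrt[OF tr, symmetric]
      by (auto elim: successively_mono)
    then have "distinct vs" by (induction vs) auto
    moreover have "set vs \<subseteq> ?A"
    proof -
      have "vs = butlast vs @ [x]" using vs unfolding chains_def by auto
      then have "sorted_wrt ?P (butlast vs @ [x])" "set vs = insert x (set (butlast vs))"
        using sorted by (metis, metis list.simps(15) rotate1.simps(2) set_rotate1)
      then show ?thesis unfolding sorted_wrt_append scope_le_def by auto
    qed
    ultimately show ?thesis using card_mono[of ?A "set vs"] by (simp add: distinct_card)
  qed
  then have "chains R x \<subseteq> {vs. set vs \<subseteq> ?A \<and> length vs \<le> card ?A}" by blast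
  then show ?thesis by (rule finite_subset) (simp add: finite_lists_length_le)
qed

context
  fixes R :: "'v rel"
  assumes R: "\<And>u v. (u, v) \<in> R \<Longrightarrow> u \<noteq> v \<Longrightarrow> (u, v) \<in> scope_le \<phi>"
begin

lemma chain_depth_le:
  "x \<in> bound_vars \<phi> \<Longrightarrow> vs \<in> chains R x \<Longrightarrow> chain_depth \<phi> vs \<le> depth \<phi> R x"
  using finite_chains[OF R] by (simp add: depth_eq)

lemma depth_attained:
  assumes "x \<in> bound_vars \<phi>"
  obtains vs where "vs \<in> chains R x" "depth \<phi> R x = chain_depth \<phi> vs"
proof -
  have "[x] \<in> chains R x" unfolding chains_def by simp
  then have "depth \<phi> R x \<in> chain_depth \<phi> ` chains R x"
    using finite_chains[OF R] assms by (auto simp: depth_eq intro!: Max_in)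
  then show ?thesis using that by blast
qed

lemma depth_pos: "x \<in> bound_vars \<phi> \<Longrightarrow> 0 < depth \<phi> R x"
  by (erule depth_attained) (simp add: chain_depth_def)

lemma depth_step:
  assumes "(x, y) \<in> R" "x \<noteq> y"
  shows "depth \<phi> R x + (if quantifier_of \<phi> x \<noteq> quantifier_of \<phi> y then 1 else 0) \<le> depth \<phi> R y"
proof -
  have b: "x \<in> bound_vars \<phi>" "y \<in> bound_vars \<phi>" using R[OF assms] unfolding scope_le_def by auto
  obtain vs where vs: "vs \<in> chains R x" "depth \<phi> R x = chain_depth \<phi> vs" using depth_attained[OF b(1)] .
  have "chain_depth \<phi> (vs @ [y]) \<le> depth \<phi> R y" using chain_depth_le[OF b(2) chains_snoc[OF vs(1) assms]] .
  then show ?thesis using vs chain_depth_snoc[of vs \<phi> y] unfolding chains_def by auto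
qed

lemma depth_mono_predecessors:
  assumes x: "x \<in> bound_vars \<phi>" and y: "y \<in> bound_vars \<phi>"
    and Q: "quantifier_of \<phi> x = quantifier_of \<phi> y"
    and pre: "\<And>w. (w, x) \<in> R \<Longrightarrow> w \<noteq> x \<Longrightarrow> (w, y) \<in> R \<and> w \<noteq> y"
  shows "depth \<phi> R x \<le> depth \<phi> R y"
proof -
  obtain vs where vs: "vs \<in> chains R x" "depth \<phi> R x = chain_depth \<phi> vs" using depth_attained[OF x] .
  define us where "us = butlast vs"
  have vs_eq: "vs = us @ [x]" using vs(1) unfolding chains_def us_def by auto
  have "us @ [y] \<in> chains R y \<and> chain_depth \<phi> (us @ [y]) = chain_depth \<phi> vs"
  proof (cases "us = []")
    case True
    then show ?thesis using vs_eq Q unfolding chains_def chain_depth_def alternations_def by simp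
  next
    case False
    then have "us \<in> chains R (last us)" "(last us, x) \<in> R" "last us \<noteq> x"
      using vs(1) unfolding vs_eq chains_def by (auto simp: successively_append_iff)
    then show ?thesis
      using pre chains_snoc[of us R "last us" y] chain_depth_snoc[OF False, of \<phi>] Q vs_eq by auto
  qed
  then show ?thesis using chain_depth_le[OF y] vs(2) by metis
qed

end

end

section \<open>From alternation depth to essential alternation depth\<close>

lemma depth_forest_formula:
  assumes straight: "straight \<phi>"
  shows "depth_forest (bound_vars \<phi>) (scope_le \<phi>)
    (essential_le \<phi> \<inter> bound_vars \<phi> \<times> bound_vars \<phi>) (entangled_rel \<phi> (essential_le \<phi>))
    (atom_adjacent \<phi>) (quantifier_of \<phi>) (ead \<phi>) (ad \<phi>)"
proof -
  let ?A = "bound_vars \<phi>" and ?E = "essential_le \<phi>"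
  note ess = essential_le_props[OF straight]
  note ess_scope = essential_le_scope_le[OF straight]
  have scope_bound: "scope_le \<phi> \<subseteq> ?A \<times> ?A" unfolding scope_le_def by auto
  have scope_refl: "x \<in> ?A \<Longrightarrow> (x, x) \<in> scope_le \<phi>" for x unfolding scope_le_def by auto
  have ess_refl: "x \<in> ?A \<Longrightarrow> (x, x) \<in> ?E" for x
    using ess(2) unfolding vars_def by (auto dest: refl_onD)
  show ?thesis
  proof
    show "finite ?A" by simp
    show "(x, y) \<in> scope_le \<phi> \<or> (y, x) \<in> scope_le \<phi>"
      if "(x, z) \<in> scope_le \<phi>" "(y, z) \<in> scope_le \<phi>" for x y z
      using that prefix_same_cases unfolding scope_le_iff[OF straight] by blast
    show "sym (atom_adjacent \<phi>)" unfolding atom_adjacent_def sym_def by blast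
    show "atom_adjacent \<phi> \<subseteq> entangled_rel \<phi> ?E"
    proof clarify
      fix x y assume "(x, y) \<in> atom_adjacent \<phi>"
      then obtain a where a: "x \<in> ?A" "y \<in> ?A" "a \<in> atoms \<phi>" "x \<in> atom_vars a" "y \<in> atom_vars a"
        unfolding atom_adjacent_def by auto
      have "x \<in> vars (minimal_subformula \<phi> {z. (y, z) \<in> ?E})"
        using atom_vars_minimal_subformula[OF a(3,5), of "{z. (y, z) \<in> ?E}"] a ess_refl by auto
      moreover have "y \<in> vars (minimal_subformula \<phi> {z. (x, z) \<in> ?E})"
        using atom_vars_minimal_subformula[OF a(3,4), of "{z. (x, z) \<in> ?E}"] a ess_refl by auto
      ultimately show "(x, y) \<in> entangled_rel \<phi> ?E"
        using a unfolding entangled_rel_def entangled_def by simp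
    qed
    show "(x, y) \<in> scope_le \<phi> \<or> (y, x) \<in> scope_le \<phi>" if "(x, y) \<in> atom_adjacent \<phi>" for x y
      using that atom_comparable[OF straight] unfolding atom_adjacent_def by auto
    show "?E \<inter> ?A \<times> ?A \<subseteq> scope_le \<phi>" using ess_scope scope_refl by auto
    show "trans (?E \<inter> ?A \<times> ?A)"
      by (rule transI) (auto dest: transD[OF ess(3)])
    show "(x, y) \<in> ?E \<inter> ?A \<times> ?A" if xy: "(x, y) \<in> scope_le \<phi>" "quantifier_of \<phi> x \<noteq> quantifier_of \<phi> y"
      and path: "(x, y) \<in> {(a, b) \<in> entangled_rel \<phi> ?E. (x, a) \<in> ?E \<inter> ?A \<times> ?A \<or> (y, a) \<in> ?E \<inter> ?A \<times> ?A}\<^sup>*"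
      for x y
    proof -
      have "(x, y) \<in> {(a, b) \<in> entangled_rel \<phi> ?E. (x, a) \<in> ?E \<or> (y, a) \<in> ?E}\<^sup>*"
        by (rule rtrancl_mono[THEN subsetD, OF _ path]) auto
      then have "(x, y) \<in> direct_rel \<phi> ?E" using xy unfolding direct_rel_def by simp
      then show ?thesis using ess(4) xy(1) scope_bound by auto
    qed
    show "\<exists>w. (x, w) \<in> ?E \<inter> ?A \<times> ?A \<and> (w, y) \<in> ?E \<inter> ?A \<times> ?A \<and> quantifier_of \<phi> w \<noteq> quantifier_of \<phi> y \<and>
        (w, y) \<in> {(a, b) \<in> entangled_rel \<phi> ?E. (w, a) \<in> ?E \<inter> ?A \<times> ?A}\<^sup>*"
      if xy: "(x, y) \<in> ?E \<inter> ?A \<times> ?A" "x \<noteq> y" for x y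
    proof -
      obtain w where w: "(x, w) \<in> ?E" "(w, y) \<in> direct_rel \<phi> ?E"
        using essential_le_last[OF straight] xy by blast
      then have wy: "(w, y) \<in> ?E" "(w, y) \<in> scope_le \<phi>" "quantifier_of \<phi> w \<noteq> quantifier_of \<phi> y"
        and path: "(w, y) \<in> {(a, b) \<in> entangled_rel \<phi> ?E. (w, a) \<in> ?E \<or> (y, a) \<in> ?E}\<^sup>*"
        using ess(4) unfolding direct_rel_def by auto
      have b: "w \<in> ?A" "y \<in> ?A" using wy(2) scope_bound by auto
      have "{(a, b) \<in> entangled_rel \<phi> ?E. (w, a) \<in> ?E \<or> (y, a) \<in> ?E} \<subseteq>
          {(a, b) \<in> entangled_rel \<phi> ?E. (w, a) \<in> ?E \<inter> ?A \<times> ?A}"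
        using transD[OF ess(3) wy(1)] b unfolding entangled_rel_def by auto
      then have "(w, y) \<in> {(a, b) \<in> entangled_rel \<phi> ?E. (w, a) \<in> ?E \<inter> ?A \<times> ?A}\<^sup>*"
        by (rule rtrancl_mono[THEN subsetD, OF _ path])
      then show ?thesis using w wy b xy by blast
    qed
    show "ead \<phi> x < ead \<phi> y" if "(x, y) \<in> ?E \<inter> ?A \<times> ?A" "quantifier_of \<phi> x \<noteq> quantifier_of \<phi> y" for x y
      using depth_step[OF straight, of ?E x y] ess_scope that unfolding ead_def by fastforce
    show "ead \<phi> x \<le> ead \<phi> y"
      if xy: "x \<in> ?A" "y \<in> ?A" "quantifier_of \<phi> x = quantifier_of \<phi> y"
        and pre: "\<And>w. (w, x) \<in> ?E \<inter> ?A \<times> ?A \<Longrightarrow> w \<noteq> x \<Longrightarrow> (w, y) \<in> ?E \<inter> ?A \<times> ?A \<and> w \<noteq> y" for x y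
      unfolding ead_def
    proof (rule depth_mono_predecessors[OF straight _ xy])
      show "(u, v) \<in> scope_le \<phi>" if "(u, v) \<in> ?E" "u \<noteq> v" for u v using ess_scope[OF that] .
      fix w assume "(w, x) \<in> ?E" "w \<noteq> x"
      moreover then have "w \<in> ?A" using ess_scope scope_bound by blast
      ultimately show "(w, y) \<in> ?E \<and> w \<noteq> y" using pre[of w] xy(1) by blast
    qed
    show "ad \<phi> x \<le> ad \<phi> y" if "(x, y) \<in> scope_le \<phi>" for x y
      using depth_step[OF straight, of "scope_le \<phi>" x y] that unfolding ad_def by (cases "x = y") auto
    show "ad \<phi> x < ad \<phi> y" if "(x, y) \<in> scope_le \<phi>" "quantifier_of \<phi> x \<noteq> quantifier_of \<phi> y" for x y
      using depth_step[OF straight, of "scope_le \<phi>" x y] that unfolding ad_def by fastforce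
  qed (use scope_bound scope_refl ess_refl scope_le_trans[OF straight] scope_le_antisym[OF straight] in auto)
qed

lemma refine_rank:
  fixes f q :: "'v \<Rightarrow> nat"
  assumes "finite V" and "inj_on q V"
  obtains p :: "'v \<Rightarrow> nat" where "inj_on p V"
    and "\<And>u v. u \<in> V \<Longrightarrow> v \<in> V \<Longrightarrow> f u < f v \<Longrightarrow> p u < p v"
    and "\<And>u v. u \<in> V \<Longrightarrow> v \<in> V \<Longrightarrow> f u = f v \<Longrightarrow> p u \<le> p v \<longleftrightarrow> q u \<le> q v"
proof -
  define M where "M = Suc (Max (insert 0 (q ` V)))"
  define p where "p v = f v * M + q v" for v
  have qM: "q v < M" if "v \<in> V" for v
    using assms(1) that unfolding M_def by (simp add: less_Suc_eq_le)
  have less: "p u < p v" if "u \<in> V" "v \<in> V" "f u < f v" for u v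
  proof -
    have "p u < f u * M + M" using qM[OF that(1)] unfolding p_def by simp
    also have "\<dots> = Suc (f u) * M" by simp
    also have "\<dots> \<le> f v * M" using that(3) by (intro mult_le_mono1) simp
    also have "\<dots> \<le> p v" unfolding p_def by simp
    finally show ?thesis .
  qed
  have eq: "p u \<le> p v \<longleftrightarrow> q u \<le> q v" if "f u = f v" for u v
    using that unfolding p_def by simp
  have "inj_on p V"
  proof (rule inj_onI)
    fix u v assume uv: "u \<in> V" "v \<in> V" "p u = p v"
    then have "f u = f v" using less[of u v] less[of v u] by (metis linorder_neqE_nat less_irrefl)
    then have "q u = q v" using uv(3) unfolding p_def by simp
    then show "u = v" using uv assms(2) by (auto dest: inj_onD)
  qed
  then show ?thesis using that less eq by blast
qed

lemma upper_component_vertices: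
  assumes "E \<subseteq> V \<times> V" and "x \<in> V" and "c \<in> upper_component E p x"
  shows "c \<in> V" and "p x \<le> p c"
proof -
  have "(x, c) \<in> (E \<inter> {v. p x \<le> p v} \<times> {v. p x \<le> p v})\<^sup>*"
    using assms(3) unfolding upper_component_def by simp
  then have "c \<in> V \<and> p x \<le> p c" by induction (use assms in auto)
  then show "c \<in> V" "p x \<le> p c" by auto
qed

definition graph_rel :: "'v graph \<Rightarrow> 'v rel" where
  "graph_rel G = {(u, v). u \<noteq> v \<and> {u, v} \<in> snd G}"

lemma formula_graph_rel:
  assumes "straight \<phi>"
  shows "fst (formula_graph \<phi>) = vars \<phi>"
    and "graph_rel (formula_graph \<phi>) \<subseteq> vars \<phi> \<times> vars \<phi>"
    and "\<And>u v. (u, v) \<in> graph_rel (formula_graph \<phi>) \<Longrightarrow> u \<in> bound_vars \<phi> \<Longrightarrow> v \<in> bound_vars \<phi> \<Longrightarrow>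
      (u, v) \<in> atom_adjacent \<phi>"
proof -
  let ?E = "graph_rel (formula_graph \<phi>)"
  have E: "u \<in> free_vars \<phi> \<and> v \<in> free_vars \<phi> \<or> (\<exists>a\<in>atoms \<phi>. u \<in> atom_vars a \<and> v \<in> atom_vars a)"
    if "(u, v) \<in> ?E" for u v
    using that unfolding graph_rel_def formula_graph_def by (auto simp: doubleton_eq_iff)
  show "fst (formula_graph \<phi>) = vars \<phi>" unfolding formula_graph_def by simp
  have "u \<in> vars \<phi> \<and> v \<in> vars \<phi>" if "(u, v) \<in> ?E" for u v
    using E[OF that] atom_vars_subset[of _ \<phi>] unfolding vars_def by blast
  then show "?E \<subseteq> vars \<phi> \<times> vars \<phi>" by auto
  show "(u, v) \<in> atom_adjacent \<phi>" if "(u, v) \<in> ?E" "u \<in> bound_vars \<phi>" "v \<in> bound_vars \<phi>" for u v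
    using E[OF that(1)] that(2,3) free_not_bound[OF assms] unfolding atom_adjacent_def by blast
qed

lemma formula_component_rank:
  fixes p q :: "'v \<Rightarrow> nat" and \<phi> :: "('v, 'c, 'r) fm"
  defines "E \<equiv> graph_rel (formula_graph \<phi>)"
  assumes straight: "straight \<phi>" and x: "x \<in> vars \<phi>"
    and q: "\<forall>u\<in>vars \<phi>. \<forall>v\<in>vars \<phi>. ad \<phi> u < ad \<phi> v \<longrightarrow> q u < q v"
    and p: "\<forall>u\<in>vars \<phi>. \<forall>v\<in>vars \<phi>. ead \<phi> u < ead \<phi> v \<longrightarrow> p u < p v"
    and pq: "\<forall>u\<in>vars \<phi>. \<forall>v\<in>vars \<phi>. ead \<phi> u = ead \<phi> v \<longrightarrow> (p u \<le> p v \<longleftrightarrow> q u \<le> q v)"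
  shows "\<And>c. c \<in> upper_component E p x \<Longrightarrow> q x \<le> q c"
    and "\<And>c u. c \<in> upper_component E p x \<Longrightarrow> (c, u) \<in> E \<Longrightarrow> p u < p x \<Longrightarrow> q u \<le> q x"
proof -
  let ?A = "bound_vars \<phi>" and ?C = "upper_component E p x"
  interpret depth_forest ?A "scope_le \<phi>" "essential_le \<phi> \<inter> ?A \<times> ?A" "entangled_rel \<phi> (essential_le \<phi>)"
    "atom_adjacent \<phi>" "quantifier_of \<phi>" "ead \<phi>" "ad \<phi>"
    by (rule depth_forest_formula[OF straight])
  note EV = formula_graph_rel(2)[OF straight, folded E_def]
  note E_adj = formula_graph_rel(3)[OF straight, folded E_def]
  note comp = upper_component_vertices[OF EV x]
  have AV: "?A \<subseteq> vars \<phi>" unfolding vars_def by auto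
  have zero: "ead \<phi> v = 0" "ad \<phi> v = 0" if "v \<notin> ?A" for v
    using that unfolding ead_def ad_def depth_def by auto
  have pos: "0 < ead \<phi> v" "0 < ad \<phi> v" if "v \<in> ?A" for v
    using depth_pos[OF straight _ that, of "essential_le \<phi>"] essential_le_scope_le[OF straight]
      depth_pos[OF straight _ that, of "scope_le \<phi>"] unfolding ead_def ad_def by auto
  have "(\<forall>c\<in>?C. q x \<le> q c) \<and> (\<forall>c\<in>?C. \<forall>u. (c, u) \<in> E \<longrightarrow> p u < p x \<longrightarrow> q u \<le> q x)"
  proof (cases "x \<in> ?A")
    case False
    show ?thesis
    proof (intro conjI ballI allI impI)
      fix c assume "c \<in> ?C"
      note c = comp[OF this]
      show "q x \<le> q c"
      proof (cases "c \<in> ?A")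
        case True
        then show ?thesis using q[rule_format, OF x c(1)] pos(2)[OF True] zero(2)[OF False] by simp
      next
        case c': False
        then show ?thesis using pq[rule_format, OF x c(1)] c(2) zero(1) False by simp
      qed
    next
      fix c u assume "(c, u) \<in> E" and lt: "p u < p x"
      then have u: "u \<in> vars \<phi>" using EV by auto
      have "ead \<phi> u = ead \<phi> x" using p[rule_format, OF x u] zero(1)[OF False] lt by fastforce
      then show "q u \<le> q x" using pq[rule_format, OF u x] lt by simp
    qed
  next
    case True
    have CA: "?C \<subseteq> ?A"
    proof
      fix c assume "c \<in> ?C"
      note c = comp[OF this]
      show "c \<in> ?A" using p[rule_format, OF c(1) x] pos(1)[OF True] zero(1)[of c] c(2) by fastforce
    qed
    have xC: "x \<in> ?C" unfolding upper_component_def by simp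
    have conn: "(x, c) \<in> (atom_adjacent \<phi> \<inter> ?C \<times> ?C)\<^sup>*" if "c \<in> ?C" for c
    proof -
      have "(x, c) \<in> (E \<inter> {v. p x \<le> p v} \<times> {v. p x \<le> p v})\<^sup>*"
        using that unfolding upper_component_def by simp
      then have "(x, c) \<in> (atom_adjacent \<phi> \<inter> ?C \<times> ?C)\<^sup>* \<and> c \<in> ?C"
      proof induction
        case (step y z)
        then have z: "z \<in> ?C" unfolding upper_component_def by (auto intro: rtrancl_into_rtrancl)
        then have "(y, z) \<in> atom_adjacent \<phi> \<inter> ?C \<times> ?C" using E_adj step CA by auto
        then show ?case using step z by (auto intro: rtrancl_into_rtrancl)
      qed (use xC in simp)
      then show ?thesis by simp
    qed
    have "\<forall>c\<in>?C. (x, c) \<in> (atom_adjacent \<phi> \<inter> ?C \<times> ?C)\<^sup>*" "\<forall>c\<in>?C. p x \<le> p c"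
      "\<forall>u\<in>?A. \<forall>v\<in>?A. ad \<phi> u < ad \<phi> v \<longrightarrow> q u < q v"
      "\<forall>u\<in>?A. \<forall>v\<in>?A. ead \<phi> u < ead \<phi> v \<longrightarrow> p u < p v"
      "\<forall>u\<in>?A. \<forall>v\<in>?A. ead \<phi> u = ead \<phi> v \<longrightarrow> (p u \<le> p v \<longleftrightarrow> q u \<le> q v)"
      using conn comp(2) q p pq AV by (simp_all add: subset_iff)
    note rank = component_rank[OF xC CA this]
    have "q u \<le> q x" if c: "c \<in> ?C" "(c, u) \<in> E" and lt: "p u < p x" for c u
    proof (cases "u \<in> ?A")
      case u: True
      then show ?thesis using rank(2)[OF c(1) E_adj[OF c(2)] u lt] c(1) CA by blast
    next
      case u: False
      have "u \<in> vars \<phi>" using c(2) EV by auto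
      then show ?thesis using q[rule_format, OF _ x, of u] zero(2)[OF u] pos(2)[OF True] by simp
    qed
    then show ?thesis using rank(1) by blast
  qed
  then show "\<And>c. c \<in> ?C \<Longrightarrow> q x \<le> q c"
    and "\<And>c u. c \<in> ?C \<Longrightarrow> (c, u) \<in> E \<Longrightarrow> p u < p x \<Longrightarrow> q u \<le> q x" by blast+
qed

lemma ead_stratified_from_ad_stratified:
  fixes \<phi> :: "('v, 'c, 'r) fm" and N :: "'t set"
  assumes straight: "straight \<phi>"
    and td: "tree_decomposition (formula_graph \<phi>) N F r B"
    and st: "stratified (formula_graph \<phi>) (ad \<phi>) N F r B"
  shows "\<exists>(N' :: nat set) F' r' B'. tree_decomposition (formula_graph \<phi>) N' F' r' B' \<and>
    stratified (formula_graph \<phi>) (ead \<phi>) N' F' r' B' \<and> width N' B' \<le> width N B"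
proof -
  let ?G = "formula_graph \<phi>" and ?V = "vars \<phi>" and ?t = "top_node N F r B"
  define E where "E = graph_rel ?G"
  note V = formula_graph_rel(1)[OF straight]
  note EV = formula_graph_rel(2)[OF straight, folded E_def]
  have tree: "rooted_tree N F r" using td unfolding tree_decomposition_def by blast
  obtain i :: "'v \<Rightarrow> nat" where "inj_on i ?V" using finite_imp_inj_to_nat_seg[OF finite_vars[of \<phi>]] by blast
  then obtain q1 :: "'v \<Rightarrow> nat" where q1: "inj_on q1 ?V"
    "\<And>u v. u \<in> ?V \<Longrightarrow> v \<in> ?V \<Longrightarrow> root_distance F r (?t u) < root_distance F r (?t v) \<Longrightarrow> q1 u < q1 v"
    by (rule refine_rank[OF finite_vars, where f = "\<lambda>v. root_distance F r (?t v)"]) blast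
  obtain q :: "'v \<Rightarrow> nat" where q: "inj_on q ?V"
    "\<And>u v. u \<in> ?V \<Longrightarrow> v \<in> ?V \<Longrightarrow> ad \<phi> u < ad \<phi> v \<Longrightarrow> q u < q v"
    "\<And>u v. u \<in> ?V \<Longrightarrow> v \<in> ?V \<Longrightarrow> ad \<phi> u = ad \<phi> v \<Longrightarrow> q u \<le> q v \<longleftrightarrow> q1 u \<le> q1 v"
    by (rule refine_rank[OF finite_vars q1(1), where f = "ad \<phi>"]) blast
  obtain p :: "'v \<Rightarrow> nat" where p: "inj_on p ?V"
    "\<And>u v. u \<in> ?V \<Longrightarrow> v \<in> ?V \<Longrightarrow> ead \<phi> u < ead \<phi> v \<Longrightarrow> p u < p v"
    "\<And>u v. u \<in> ?V \<Longrightarrow> v \<in> ?V \<Longrightarrow> ead \<phi> u = ead \<phi> v \<Longrightarrow> p u \<le> p v \<longleftrightarrow> q u \<le> q v"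
    by (rule refine_rank[OF finite_vars q(1), where f = "ead \<phi>"]) blast
  have q_tree: "q u < q v" if uv: "u \<in> ?V" "v \<in> ?V" "(?t u, ?t v) \<in> F\<^sup>+" for u v
  proof (cases "ad \<phi> u < ad \<phi> v")
    case False
    then have "ad \<phi> u = ad \<phi> v" using st uv V unfolding stratified_def by (simp add: order.antisym)
    moreover have "q1 u < q1 v" using q1(2) uv root_distance_trancl[OF tree] by blast
    ultimately show ?thesis using q(3)[OF uv(2,1)] by simp
  qed (use q(2) uv in simp)
  have bag: "insert x (lower_boundary E p x) \<subseteq> B (?t x)" if x: "x \<in> ?V" for x
  proof -
    have "\<forall>u\<in>?V. \<forall>v\<in>?V. ad \<phi> u < ad \<phi> v \<longrightarrow> q u < q v"
      "\<forall>u\<in>?V. \<forall>v\<in>?V. ead \<phi> u < ead \<phi> v \<longrightarrow> p u < p v"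
      "\<forall>u\<in>?V. \<forall>v\<in>?V. ead \<phi> u = ead \<phi> v \<longrightarrow> (p u \<le> p v \<longleftrightarrow> q u \<le> q v)"
      using q(2) p(2,3) by simp_all
    note rank = formula_component_rank[OF straight x this, folded E_def]
    have EG: "{a, b} \<in> snd ?G \<and> a \<in> fst ?G \<and> b \<in> fst ?G" if "(a, b) \<in> E" for a b
      using that EV V unfolding E_def graph_rel_def by auto
    have above: "(?t c, ?t x) \<notin> F\<^sup>+" if "(x, c) \<in> (E \<inter> {v. p x \<le> p v} \<times> {v. p x \<le> p v})\<^sup>*" for c
    proof
      assume "(?t c, ?t x) \<in> F\<^sup>+"
      moreover have c: "c \<in> upper_component E p x" using that unfolding upper_component_def by simp
      ultimately have "q c < q x" using q_tree upper_component_vertices(1)[OF EV x] x by blast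
      then show False using rank(1)[OF c] by simp
    qed
    have "u \<in> B (?t x)" if u: "u \<in> lower_boundary E p x" for u
    proof -
      obtain c where c: "c \<in> upper_component E p x" "(c, u) \<in> E" "p u < p x"
        using u unfolding lower_boundary_def by auto
      have "q u \<le> q x" using rank(2)[OF c] .
      then have "(?t x, ?t u) \<notin> F\<^sup>+" using q_tree[OF x, of u] c(2) EV by fastforce
      show ?thesis
      proof (rule boundary_in_top_bag[OF td _ EG _ above c(2)])
        show "(x, c) \<in> (E \<inter> {v. p x \<le> p v} \<times> {v. p x \<le> p v})\<^sup>*"
          using c(1) unfolding upper_component_def by simp
      qed (use x V \<open>(?t x, ?t u) \<notin> F\<^sup>+\<close> in auto)
    qed
    then show ?thesis using top_node_props(2)[OF td] x V by auto
  qed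
  have edges: "\<exists>u v. e = {u, v} \<and> (u, v) \<in> E" if e: "e \<in> snd ?G" for e
  proof -
    obtain u v where "e = {u, v}" "u \<noteq> v" using e unfolding formula_graph_def by auto
    then show ?thesis using e unfolding E_def graph_rel_def by blast
  qed
  have symE: "sym E" unfolding E_def graph_rel_def sym_def by (auto simp: insert_commute)
  have irreflE: "irrefl E" unfolding E_def graph_rel_def irrefl_def by auto
  have mono: "ead \<phi> u \<le> ead \<phi> v" if "u \<in> ?V" "v \<in> ?V" "p u < p v" for u v
    using p(2)[OF that(2,1)] that(3) by (meson leI less_asym)
  have "\<exists>(N' :: nat set) F' r' B'. tree_decomposition ?G N' F' r' B' \<and>
      stratified ?G (ead \<phi>) N' F' r' B' \<and>
      (\<forall>t\<in>N'. B' t = {} \<or> (\<exists>x\<in>fst ?G. B' t = insert x (lower_boundary E p x)))"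
    by (rule elimination_tree_decomposition) (use edges EV symE irreflE p(1) mono in \<open>simp_all add: V\<close>)
  then obtain N' :: "nat set" and F' r' B' where N': "tree_decomposition ?G N' F' r' B'"
    "stratified ?G (ead \<phi>) N' F' r' B'"
    "\<forall>t\<in>N'. B' t = {} \<or> (\<exists>x\<in>?V. B' t = insert x (lower_boundary E p x))"
    unfolding V by blast
  have finN: "finite N" "finite N'" "N' \<noteq> {}"
    using tree N'(1) unfolding tree_decomposition_def rooted_tree_def by auto
  have "card (B' t) \<le> Max ((\<lambda>t. card (B t)) ` N)" if "t \<in> N'" for t
  proof -
    from N'(3) that consider "B' t = {}" | x where "x \<in> ?V" "B' t = insert x (lower_boundary E p x)"
      by blast
    then show ?thesis
    proof cases
      case (2 x)
      have tx: "?t x \<in> N" using top_node_props(1)[OF td] 2(1) V by simp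
      then have "B (?t x) \<subseteq> ?V" using td V unfolding tree_decomposition_def by auto
      then have "finite (B (?t x))" using finite_vars by (rule finite_subset)
      then have "card (B' t) \<le> card (B (?t x))" using bag[OF 2(1)] 2(2) by (simp add: card_mono)
      also have "\<dots> \<le> Max ((\<lambda>t. card (B t)) ` N)" using tx finN by simp
      finally show ?thesis .
    qed simp
  qed
  then have "Max ((\<lambda>t. card (B' t)) ` N') \<le> Max ((\<lambda>t. card (B t)) ` N)" using finN by simp
  then have "width N' B' \<le> width N B" unfolding width_def by simp
  then show ?thesis using N' by blast
qed

lemma single_node_tree_decomposition:
  assumes "\<And>e. e \<in> snd G \<Longrightarrow> e \<subseteq> fst G"
  shows "tree_decomposition G {r} {} r (\<lambda>_. fst G)" and "stratified G d {r} {} r (\<lambda>_. fst G)"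
  using assms
  by (auto simp: tree_decomposition_def rooted_tree_def tree_connected_def stratified_def)

theorem theorem3p25:
  fixes \<phi> :: "('v, 'c, 'r) fm"
  assumes "straight \<phi>"
  shows "fotw \<phi> \<le> tw (formula_graph \<phi>) (ad \<phi>)"
  unfolding fotw_def tw_def
proof (rule cInf_mono)
  let ?G = "formula_graph \<phi>"
  have "e \<subseteq> fst ?G" if "e \<in> snd ?G" for e
    using that atom_vars_subset[of _ \<phi>] unfolding formula_graph_def vars_def by auto
  note single = single_node_tree_decomposition[where G = ?G and r = "0 :: nat", OF this]
  show "{width N B |(N :: nat set) F r B. tree_decomposition ?G N F r B \<and> stratified ?G (ad \<phi>) N F r B} \<noteq> {}"
    using single by blast
  show "bdd_below {width N B |(N :: nat set) F r B.
      tree_decomposition ?G N F r B \<and> stratified ?G (ead \<phi>) N F r B}"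
    by (rule bdd_belowI[of _ "-1"]) (auto simp: width_def)
  fix b assume "b \<in> {width N B |(N :: nat set) F r B.
      tree_decomposition ?G N F r B \<and> stratified ?G (ad \<phi>) N F r B}"
  then obtain N :: "nat set" and F r B where b: "b = width N B"
    and "tree_decomposition ?G N F r B" "stratified ?G (ad \<phi>) N F r B"
    by blast
  then obtain N' :: "nat set" and F' r' B' where "tree_decomposition ?G N' F' r' B'"
    "stratified ?G (ead \<phi>) N' F' r' B'" and le: "width N' B' \<le> width N B"
    using ead_stratified_from_ad_stratified[OF assms, of N F r B] by blast
  then have "width N' B' \<in> {width N B |(N :: nat set) F r B.
      tree_decomposition ?G N F r B \<and> stratified ?G (ead \<phi>) N F r B}"
    by blast
  then show "\<exists>a\<in>{width N B |(N :: nat set) F r B.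
      tree_decomposition ?G N F r B \<and> stratified ?G (ead \<phi>) N F r B}. a \<le> b"
    using le unfolding b by (rule bexI[rotated])
qed

end
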